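(* Let $S$ be a finite $p$-group, $\mathcal D=(\mathcal Q,\mathcal A)$ a fusion datum on $S$ and $\mathcal F=\mathcal F(\mathcal D)$. The procedures based on the fusion graph $\Gamma(\mathcal D)$ described in the context calculate $\mathrm{Aut}_{\mathcal F}(P)$ for all $P\le S$, determine $\mathcal F$-conjugacy between subgroups, and check whether $\mathcal D$ is an automizer sequence. That is: (i) for all $P,R\le S$, $P$ and $R$ are $\mathcal F$-conjugate if and only if $[P]$ and $[R]$ lie in the same connected component of $\Gamma(\mathcal D)$, and in this case $\Theta_{P,R}\in\mathrm{Hom}_{\mathcal F}(P,R)$; (ii) for all $P\le S$, $\mathrm{Aut}_{\mathcal F}(P)=A_P$ (whatever choices are made in the construction of the maps $\Theta_{X,Y}$); (iii) $\mathcal D$ is an automizer sequence if and only if for each $Q\in\mathcal Q$: $A_Q=\mathcal A(Q)$; every vertex $X$ in the connected component of $\Gamma(\mathcal D)$ containing $Q$ satisfies $C_S(X)=Z(X)$; $\mathrm{Aut}_S(Q)\in\mathrm{Syl}_p(\mathcal A(Q))$; and, if $Q\neq S$, $\mathcal A(Q)/\mathrm{Inn}(Q)$ has a strongly $p$-embedded subgroup.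
   Context: Maps are written on the right. A fusion system $\mathcal F$ on a finite $p$-group $S$ is a category whose objects are the subgroups of $S$ such that for $P,Q\le S$: $\mathrm{Hom}_S(P,Q)\subseteq \mathrm{Hom}_{\mathcal F}(P,Q)\subseteq \mathrm{Inj}(P,Q)$ ($S$-conjugation maps, respectively injective homomorphisms), and every $\varphi\in\mathrm{Hom}_{\mathcal F}(P,Q)$ factorizes as an $\mathcal F$-isomorphism $P\to P\varphi$ followed by inclusion. $P^{\mathcal F}=\{P\alpha\mid\alpha\in\mathrm{Hom}_{\mathcal F}(P,S)\}$ is the $\mathcal F$-conjugacy class of $P$. $P$ is $S$-centric if $C_S(P)=Z(P)$, and $\mathcal F$-centric if every member of $P^{\mathcal F}$ is $S$-centric. A fusion datum on $S$ is a pair $\mathcal D=(\mathcal Q,\mathcal A)$ where (1) $\mathcal Q$ is a sequence of $S$-centric subgroups of $S$ with first element $S$; (2) $\mathcal A$ assigns to each $Q\in\mathcal Q$ a subgroup $\mathcal A(Q)\le\mathrm{Aut}(Q)$ containing $\mathrm{Aut}_S(Q)$; (3) no two members of $\mathcal Q$ are in the same $\mathcal A(S)$-orbit. $\mathcal F(\mathcal D)=\langle\mathcal A(Q)\mid Q\in\mathcal Q\rangle$ is the smallest fusion system on $S$ containing every $\mathcal A(Q)$. $\mathcal D$ is an automizer sequence if, with $\mathcal F=\mathcal F(\mathcal D)$, for each $Q\in\mathcal Q$: (1) $\mathcal A(Q)=\mathrm{Aut}_{\mathcal F}(Q)$; (2) $Q$ is $\mathcal F$-centric; (3) $\mathrm{Aut}_S(Q)$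 is a Sylow $p$-subgroup of $\mathcal A(Q)$; (4) if $Q\ne S$, $\mathcal A(Q)/\mathrm{Inn}(Q)$ has a strongly $p$-embedded subgroup. Fusion graph. Let $S/\mathcal D$ be a fixed set of $\mathcal A(S)$-orbit representatives of the subgroups of $S$ which contains every $Q\in\mathcal Q$; for $X\le S$ let $[X]\in S/\mathcal D$ be the representative of $X$. The fusion graph $\Gamma(\mathcal D)$ has vertex set $S/\mathcal D$, and its edges are the $2$-element sets $\{R,T\}\subseteq S/\mathcal D$ for which there are $\alpha,\gamma\in\mathcal A(S)$, $Q\in\mathcal Q$ and $\beta\in\mathcal A(Q)$ with $R\alpha,T\gamma\le Q$ and $R\alpha\beta=T\gamma$. The maps $\Theta$. For each edge $\{R,T\}$ with a chosen orientation $[R,T]$ choose such $\alpha,\beta,\gamma$ and put $\Theta_{R,T}=\alpha\beta\gamma^{-1}:R\to T$ (appropriately restricted) and $\Theta_{T,R}=\Theta_{R,T}^{-1}$. For distinct $X,Y\in S/\mathcal D$ in the same connected component, choose an orientation $[X,Y]$ and a path from $X$ to $Y$, let $\Theta_{X,Y}$ be the product of the edge maps along the path, and put $\Theta_{Y,X}=\Theta_{X,Y}^{-1}$. Let $\Theta_{X,X}$ be the identity map for every $X\le S$. For distinct subgroups $X',Y'\le S$ with $[X']=X$, $[Y']=Y$ in the same connected component, choose $\beta,\delta\in\mathcal A(S)$ with $X'=X\beta$, $Y'=Y\delta$ and put $\Theta_{X',Y'}=\beta^{-1}\Theta_{X,Y}\delta$ and $\Theta_{Y',X'}=\Theta_{X',Y'}^{-1}$.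 The group $A_P$. For $P\le S$ the class $P^{\mathcal F}$ is read off as $\{X\beta\mid X \text{ a vertex in the component of }[P],\ \beta\in\mathcal A(S)\}$. For $T\in P^{\mathcal F}$ let $\mathcal Q^{\ge T}=\{Q\in\mathcal Q\mid T\le Q\}$ and $$C_T=\langle \Theta_{T,T\mu}(\mu|_{T})^{-1}\mid \mu\in\mathcal A(Q),\ Q\in\mathcal Q^{\ge T}\rangle,$$ where $(\mu|_T)^{-1}:T\mu\to T$. Put $B_P=\langle\Theta_{P,T}\psi\Theta_{T,P}\mid T\in P^{\mathcal F},\ \psi\in C_T\rangle$ and $A_P=\langle B_P,\ \Theta_{P,R}\Theta_{R,T}\Theta_{T,P}\mid R,T\in P^{\mathcal F}\setminus\{P\}\rangle$. *)

theory Defs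
  imports
    "HOL-Algebra.Bij"
    "HOL-Algebra.Coset"
    "HOL-Algebra.Generated_Groups"
    "HOL-Computational_Algebra.Primes"
begin

text \<open>
  A map with domain \<open>P\<close> is a function that is \<^const>\<open>extensional\<close> on \<open>P\<close>. Maps are written on the
  right on paper, so the product \<open>\<phi>\<psi>\<close> with \<open>\<phi>\<close> defined on \<open>P\<close> is \<open>compose P \<psi> \<phi>\<close>, the image \<open>P\<phi>\<close> is
  \<open>\<phi> ` P\<close>, and conjugation by \<open>g\<close> is \<open>x \<mapsto> g\<^sup>-\<^sup>1 x g\<close>.
  The multiplication of \<^const>\<open>AutoGroup\<close> applies its second factor first, i.e. it is the opposite
  of the multiplication used on paper. This does not affect subgroups, generated subgroups, normal
  subgroups, Sylow subgroups or strongly embedded subgroups of (quotients of) automorphism groups.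
\<close>


subsection \<open>Finite groups\<close>

definition finite_p_group :: "nat \<Rightarrow> ('a, 'b) monoid_scheme \<Rightarrow> bool" where
  "finite_p_group p G \<longleftrightarrow>
     Factorial_Ring.prime p \<and> group G \<and> finite (carrier G) \<and> (\<exists>n. order G = p ^ n)"

definition sylow_subgroup :: "nat \<Rightarrow> ('a, 'b) monoid_scheme \<Rightarrow> 'a set \<Rightarrow> bool" where
  "sylow_subgroup p G H \<longleftrightarrow> subgroup H G \<and> card H = p ^ multiplicity p (order G)"

definition strongly_p_embedded :: "nat \<Rightarrow> ('a, 'b) monoid_scheme \<Rightarrow> 'a set \<Rightarrow> bool" where
  "strongly_p_embedded p G H \<longleftrightarrow>
     subgroup H G \<and> H \<noteq> carrier G \<and> p dvd card H \<and>
     (\<forall>g \<in> carrier G - H. \<not> p dvd card (H \<inter> (\<lambda>h. inv\<^bsub>G\<^esub> g \<otimes>\<^bsub>G\<^esub> h \<otimes>\<^bsub>G\<^esub> g) ` H))"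

definition centralizer :: "('a, 'b) monoid_scheme \<Rightarrow> 'a set \<Rightarrow> 'a set" where
  "centralizer G P = {x \<in> carrier G. \<forall>y \<in> P. x \<otimes>\<^bsub>G\<^esub> y = y \<otimes>\<^bsub>G\<^esub> x}"

definition center :: "('a, 'b) monoid_scheme \<Rightarrow> 'a set" where
  "center G = {x \<in> carrier G. \<forall>y \<in> carrier G. x \<otimes>\<^bsub>G\<^esub> y = y \<otimes>\<^bsub>G\<^esub> x}"

definition centric :: "('a, 'b) monoid_scheme \<Rightarrow> 'a set \<Rightarrow> bool" where
  "centric S P \<longleftrightarrow> centralizer S P = center (S\<lparr>carrier := P\<rparr>)"


subsection \<open>Fusion systems\<close>

type_synonym 'a maps = "'a set \<Rightarrow> 'a set \<Rightarrow> ('a \<Rightarrow> 'a) set"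

definition inv_map :: "'a set \<Rightarrow> ('a \<Rightarrow> 'a) \<Rightarrow> 'a \<Rightarrow> 'a" where
  "inv_map P \<phi> = (\<lambda>y \<in> \<phi> ` P. inv_into P \<phi> y)"

definition conj_map :: "('a, 'b) monoid_scheme \<Rightarrow> 'a set \<Rightarrow> 'a \<Rightarrow> 'a \<Rightarrow> 'a" where
  "conj_map S P g = (\<lambda>x \<in> P. inv\<^bsub>S\<^esub> g \<otimes>\<^bsub>S\<^esub> x \<otimes>\<^bsub>S\<^esub> g)"

definition Hom_S :: "('a, 'b) monoid_scheme \<Rightarrow> 'a maps" where
  "Hom_S S P Q = {conj_map S P g | g. g \<in> carrier S \<and> conj_map S P g ` P \<subseteq> Q}"

definition Inj :: "('a, 'b) monoid_scheme \<Rightarrow> 'a maps" where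
  "Inj S P Q = mon (S\<lparr>carrier := P\<rparr>) (S\<lparr>carrier := Q\<rparr>) \<inter> extensional P"

text \<open>
  A fusion system is given by its morphism sets. The first conjunct says that the objects are the
  subgroups of \<open>S\<close>; identities and inclusions are already contained in \<^const>\<open>Hom_S\<close>.
\<close>

definition fusion_system :: "('a, 'b) monoid_scheme \<Rightarrow> 'a maps \<Rightarrow> bool" where
  "fusion_system S F \<longleftrightarrow>
     (\<forall>P Q. \<not> (subgroup P S \<and> subgroup Q S) \<longrightarrow> F P Q = {}) \<and>
     (\<forall>P Q. subgroup P S \<and> subgroup Q S \<longrightarrow> Hom_S S P Q \<subseteq> F P Q \<and> F P Q \<subseteq> Inj S P Q) \<and>
     (\<forall>P Q R. \<forall>\<phi> \<in> F P Q. \<forall>\<psi> \<in> F Q R. compose P \<psi> \<phi> \<in> F P R) \<and>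
     (\<forall>P Q. \<forall>\<phi> \<in> F P Q. \<phi> \<in> F P (\<phi> ` P) \<and> inv_map P \<phi> \<in> F (\<phi> ` P) P)"

definition conj_class :: "('a, 'b) monoid_scheme \<Rightarrow> 'a maps \<Rightarrow> 'a set \<Rightarrow> 'a set set" where
  "conj_class S F P = {\<alpha> ` P | \<alpha>. \<alpha> \<in> F P (carrier S)}"

definition fusion_centric :: "('a, 'b) monoid_scheme \<Rightarrow> 'a maps \<Rightarrow> 'a set \<Rightarrow> bool" where
  "fusion_centric S F P \<longleftrightarrow> (\<forall>R \<in> conj_class S F P. centric S R)"


subsection \<open>Fusion data and automizer sequences\<close>

text \<open>A fusion datum is represented by the list \<open>Qs\<close> and the assignment \<open>\<A>\<close>, of which only the
  values on \<open>set Qs\<close> matter.\<close>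

abbreviation Aut_group :: "('a, 'b) monoid_scheme \<Rightarrow> 'a set \<Rightarrow> ('a \<Rightarrow> 'a) monoid" where
  "Aut_group S Q \<equiv> AutoGroup (S\<lparr>carrier := Q\<rparr>)"

definition Inn :: "('a, 'b) monoid_scheme \<Rightarrow> 'a set \<Rightarrow> ('a \<Rightarrow> 'a) set" where
  "Inn S Q = conj_map S Q ` Q"

definition fusion_datum ::
    "('a, 'b) monoid_scheme \<Rightarrow> 'a set list \<Rightarrow> ('a set \<Rightarrow> ('a \<Rightarrow> 'a) set) \<Rightarrow> bool" where
  "fusion_datum S Qs \<A> \<longleftrightarrow>
     (Qs \<noteq> [] \<and> hd Qs = carrier S \<and> (\<forall>Q \<in> set Qs. subgroup Q S \<and> centric S Q)) \<and>
     (\<forall>Q \<in> set Qs. subgroup (\<A> Q) (Aut_group S Q) \<and> Hom_S S Q Q \<subseteq> \<A> Q) \<and>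
     (\<forall>i < length Qs. \<forall>j < length Qs. i \<noteq> j \<longrightarrow> \<not> (\<exists>\<alpha> \<in> \<A> (carrier S). Qs ! i = \<alpha> ` (Qs ! j)))"

text \<open>
  The pointwise intersection of fusion systems is again a fusion system, and the family intersected
  here is nonempty because all injective homomorphisms form a fusion system. Hence
  \<open>generated_fusion S Qs \<A>\<close> is the smallest fusion system containing every \<open>\<A> Q\<close>.
\<close>

definition generated_fusion ::
    "('a, 'b) monoid_scheme \<Rightarrow> 'a set list \<Rightarrow> ('a set \<Rightarrow> ('a \<Rightarrow> 'a) set) \<Rightarrow> 'a maps" where
  "generated_fusion S Qs \<A> P R =
     \<Inter> {F P R | F. fusion_system S F \<and> (\<forall>Q \<in> set Qs. \<A> Q \<subseteq> F Q Q)}"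

definition has_strongly_p_embedded_outer ::
    "nat \<Rightarrow> ('a, 'b) monoid_scheme \<Rightarrow> ('a set \<Rightarrow> ('a \<Rightarrow> 'a) set) \<Rightarrow> 'a set \<Rightarrow> bool" where
  "has_strongly_p_embedded_outer p S \<A> Q \<longleftrightarrow>
     (\<exists>H. strongly_p_embedded p ((Aut_group S Q)\<lparr>carrier := \<A> Q\<rparr> Mod Inn S Q) H)"

definition automizer_sequence ::
    "nat \<Rightarrow> ('a, 'b) monoid_scheme \<Rightarrow> 'a set list \<Rightarrow> ('a set \<Rightarrow> ('a \<Rightarrow> 'a) set) \<Rightarrow> bool" where
  "automizer_sequence p S Qs \<A> \<longleftrightarrow>
     (\<forall>Q \<in> set Qs.
        \<A> Q = generated_fusion S Qs \<A> Q Q \<and>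
        fusion_centric S (generated_fusion S Qs \<A>) Q \<and>
        sylow_subgroup p ((Aut_group S Q)\<lparr>carrier := \<A> Q\<rparr>) (Hom_S S Q Q) \<and>
        (Q \<noteq> carrier S \<longrightarrow> has_strongly_p_embedded_outer p S \<A> Q))"


subsection \<open>The fusion graph\<close>

definition orbit_reps ::
    "('a, 'b) monoid_scheme \<Rightarrow> 'a set list \<Rightarrow> ('a set \<Rightarrow> ('a \<Rightarrow> 'a) set) \<Rightarrow> 'a set set \<Rightarrow> bool" where
  "orbit_reps S Qs \<A> V \<longleftrightarrow>
     (\<forall>X \<in> V. subgroup X S) \<and> set Qs \<subseteq> V \<and>
     (\<forall>X. subgroup X S \<longrightarrow> (\<exists>!R. R \<in> V \<and> (\<exists>\<alpha> \<in> \<A> (carrier S). R = \<alpha> ` X)))"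

definition rep ::
    "('a, 'b) monoid_scheme \<Rightarrow> ('a set \<Rightarrow> ('a \<Rightarrow> 'a) set) \<Rightarrow> 'a set set \<Rightarrow> 'a set \<Rightarrow> 'a set" where
  "rep S \<A> V X = (THE R. R \<in> V \<and> (\<exists>\<alpha> \<in> \<A> (carrier S). R = \<alpha> ` X))"

definition edge_data ::
    "('a, 'b) monoid_scheme \<Rightarrow> 'a set list \<Rightarrow> ('a set \<Rightarrow> ('a \<Rightarrow> 'a) set) \<Rightarrow> 'a set \<Rightarrow> 'a set \<Rightarrow>
     ('a \<Rightarrow> 'a) \<Rightarrow> 'a set \<Rightarrow> ('a \<Rightarrow> 'a) \<Rightarrow> ('a \<Rightarrow> 'a) \<Rightarrow> bool" where
  "edge_data S Qs \<A> R T \<alpha> Q \<beta> \<gamma> \<longleftrightarrow>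
     \<alpha> \<in> \<A> (carrier S) \<and> \<gamma> \<in> \<A> (carrier S) \<and> Q \<in> set Qs \<and> \<beta> \<in> \<A> Q \<and>
     \<alpha> ` R \<subseteq> Q \<and> \<gamma> ` T \<subseteq> Q \<and> \<beta> ` \<alpha> ` R = \<gamma> ` T"

definition fusion_graph_edges ::
    "('a, 'b) monoid_scheme \<Rightarrow> 'a set list \<Rightarrow> ('a set \<Rightarrow> ('a \<Rightarrow> 'a) set) \<Rightarrow> 'a set set \<Rightarrow>
     'a set set set" where
  "fusion_graph_edges S Qs \<A> V =
     {{R, T} | R T. R \<in> V \<and> T \<in> V \<and> R \<noteq> T \<and> (\<exists>\<alpha> Q \<beta> \<gamma>. edge_data S Qs \<A> R T \<alpha> Q \<beta> \<gamma>)}"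

definition component :: "'v set \<Rightarrow> 'v set set \<Rightarrow> 'v \<Rightarrow> 'v set" where
  "component V E X = {Y \<in> V. (X, Y) \<in> {(x, y). {x, y} \<in> E}\<^sup>*}"

definition graph_path :: "'v set \<Rightarrow> 'v set set \<Rightarrow> 'v \<Rightarrow> 'v list \<Rightarrow> 'v \<Rightarrow> bool" where
  "graph_path V E X xs Y \<longleftrightarrow>
     xs \<noteq> [] \<and> hd xs = X \<and> last xs = Y \<and> set xs \<subseteq> V \<and> distinct xs \<and>
     successively (\<lambda>x y. {x, y} \<in> E) xs"

abbreviation fusion_component ::
    "('a, 'b) monoid_scheme \<Rightarrow> 'a set list \<Rightarrow> ('a set \<Rightarrow> ('a \<Rightarrow> 'a) set) \<Rightarrow> 'a set set \<Rightarrow>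
     'a set \<Rightarrow> 'a set set" where
  "fusion_component S Qs \<A> V X \<equiv> component V (fusion_graph_edges S Qs \<A> V) X"


subsection \<open>The maps \<open>\<Theta>\<close>\<close>

text \<open>
  The three predicates below are the three stages of the construction: maps on edges, on pairs of
  vertices and on pairs of arbitrary subgroups. In each stage the quantifier over the ordered pair
  \<open>R, T\<close> with \<open>{R, T}\<close> given is the choice of the orientation. The stages are kept as separate
  families, so that adjacent vertices may be joined by a path other than their edge, and two
  vertices by elements \<open>\<beta>, \<delta>\<close> other than the identity; choosing the edge as the path and
  \<open>\<beta> = \<delta> = 1\<close> makes each family an extension of the preceding one.
\<close>

definition edge_maps ::
    "('a, 'b) monoid_scheme \<Rightarrow> 'a set list \<Rightarrow> ('a set \<Rightarrow> ('a \<Rightarrow> 'a) set) \<Rightarrow> 'a set set \<Rightarrow>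
     ('a set \<Rightarrow> 'a set \<Rightarrow> 'a \<Rightarrow> 'a) \<Rightarrow> bool" where
  "edge_maps S Qs \<A> V \<theta> \<longleftrightarrow>
     (\<forall>e \<in> fusion_graph_edges S Qs \<A> V. \<exists>R T. e = {R, T} \<and>
        (\<exists>\<alpha> Q \<beta> \<gamma>. edge_data S Qs \<A> R T \<alpha> Q \<beta> \<gamma> \<and>
           \<theta> R T = (\<lambda>x \<in> R. inv_into (carrier S) \<gamma> (\<beta> (\<alpha> x)))) \<and>
        \<theta> T R = inv_map R (\<theta> R T))"

fun path_map :: "('a set \<Rightarrow> 'a set \<Rightarrow> 'a \<Rightarrow> 'a) \<Rightarrow> 'a set list \<Rightarrow> 'a \<Rightarrow> 'a" where
  "path_map \<theta> [] = undefined"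
| "path_map \<theta> [X] = (\<lambda>x \<in> X. x)"
| "path_map \<theta> (X # Y # Xs) = compose X (path_map \<theta> (Y # Xs)) (\<theta> X Y)"

definition vertex_maps ::
    "('a, 'b) monoid_scheme \<Rightarrow> 'a set list \<Rightarrow> ('a set \<Rightarrow> ('a \<Rightarrow> 'a) set) \<Rightarrow> 'a set set \<Rightarrow>
     ('a set \<Rightarrow> 'a set \<Rightarrow> 'a \<Rightarrow> 'a) \<Rightarrow> ('a set \<Rightarrow> 'a set \<Rightarrow> 'a \<Rightarrow> 'a) \<Rightarrow> bool" where
  "vertex_maps S Qs \<A> V \<theta> \<Theta> \<longleftrightarrow>
     (\<forall>X \<in> V. \<Theta> X X = (\<lambda>x \<in> X. x)) \<and>
     (\<forall>X \<in> V. \<forall>Y \<in> fusion_component S Qs \<A> V X. X \<noteq> Y \<longrightarrow>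
        (\<exists>R T. {X, Y} = {R, T} \<and>
           (\<exists>xs. graph_path V (fusion_graph_edges S Qs \<A> V) R xs T \<and> \<Theta> R T = path_map \<theta> xs) \<and>
           \<Theta> T R = inv_map R (\<Theta> R T)))"

definition subgroup_maps ::
    "('a, 'b) monoid_scheme \<Rightarrow> 'a set list \<Rightarrow> ('a set \<Rightarrow> ('a \<Rightarrow> 'a) set) \<Rightarrow> 'a set set \<Rightarrow>
     ('a set \<Rightarrow> 'a set \<Rightarrow> 'a \<Rightarrow> 'a) \<Rightarrow> ('a set \<Rightarrow> 'a set \<Rightarrow> 'a \<Rightarrow> 'a) \<Rightarrow> bool" where
  "subgroup_maps S Qs \<A> V \<Theta>' \<Theta> \<longleftrightarrow>
     (\<forall>X. subgroup X S \<longrightarrow> \<Theta> X X = (\<lambda>x \<in> X. x)) \<and>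
     (\<forall>X Y. subgroup X S \<and> subgroup Y S \<and> X \<noteq> Y \<and>
        rep S \<A> V Y \<in> fusion_component S Qs \<A> V (rep S \<A> V X) \<longrightarrow>
        (\<exists>R T. {X, Y} = {R, T} \<and>
           (\<exists>\<beta> \<in> \<A> (carrier S). \<exists>\<delta> \<in> \<A> (carrier S).
              R = \<beta> ` rep S \<A> V R \<and> T = \<delta> ` rep S \<A> V T \<and>
              \<Theta> R T =
                (\<lambda>x \<in> R. \<delta> (\<Theta>' (rep S \<A> V R) (rep S \<A> V T) (inv_into (carrier S) \<beta> x)))) \<and>
           \<Theta> T R = inv_map R (\<Theta> R T)))"

definition theta_maps ::
    "('a, 'b) monoid_scheme \<Rightarrow> 'a set list \<Rightarrow> ('a set \<Rightarrow> ('a \<Rightarrow> 'a) set) \<Rightarrow> 'a set set \<Rightarrow>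
     ('a set \<Rightarrow> 'a set \<Rightarrow> 'a \<Rightarrow> 'a) \<Rightarrow> bool" where
  "theta_maps S Qs \<A> V \<Theta> \<longleftrightarrow>
     (\<exists>\<theta> \<Theta>'. edge_maps S Qs \<A> V \<theta> \<and> vertex_maps S Qs \<A> V \<theta> \<Theta>' \<and> subgroup_maps S Qs \<A> V \<Theta>' \<Theta>)"


subsection \<open>The groups \<open>C\<^sub>T\<close>, \<open>B\<^sub>P\<close> and \<open>A\<^sub>P\<close>\<close>

definition graph_class ::
    "('a, 'b) monoid_scheme \<Rightarrow> 'a set list \<Rightarrow> ('a set \<Rightarrow> ('a \<Rightarrow> 'a) set) \<Rightarrow> 'a set set \<Rightarrow>
     'a set \<Rightarrow> 'a set set" where
  "graph_class S Qs \<A> V P =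
     {\<beta> ` X | X \<beta>. X \<in> fusion_component S Qs \<A> V (rep S \<A> V P) \<and> \<beta> \<in> \<A> (carrier S)}"

definition C_group ::
    "('a, 'b) monoid_scheme \<Rightarrow> 'a set list \<Rightarrow> ('a set \<Rightarrow> ('a \<Rightarrow> 'a) set) \<Rightarrow>
     ('a set \<Rightarrow> 'a set \<Rightarrow> 'a \<Rightarrow> 'a) \<Rightarrow> 'a set \<Rightarrow> ('a \<Rightarrow> 'a) set" where
  "C_group S Qs \<A> \<Theta> T =
     generate (Aut_group S T)
       {compose T (inv_map T \<mu>) (\<Theta> T (\<mu> ` T)) | \<mu> Q. Q \<in> set Qs \<and> T \<subseteq> Q \<and> \<mu> \<in> \<A> Q}"

definition B_group ::
    "('a, 'b) monoid_scheme \<Rightarrow> 'a set list \<Rightarrow> ('a set \<Rightarrow> ('a \<Rightarrow> 'a) set) \<Rightarrow> 'a set set \<Rightarrow>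
     ('a set \<Rightarrow> 'a set \<Rightarrow> 'a \<Rightarrow> 'a) \<Rightarrow> 'a set \<Rightarrow> ('a \<Rightarrow> 'a) set" where
  "B_group S Qs \<A> V \<Theta> P =
     generate (Aut_group S P)
       {compose P (\<Theta> T P) (compose P \<psi> (\<Theta> P T)) | T \<psi>.
          T \<in> graph_class S Qs \<A> V P \<and> \<psi> \<in> C_group S Qs \<A> \<Theta> T}"

definition A_group ::
    "('a, 'b) monoid_scheme \<Rightarrow> 'a set list \<Rightarrow> ('a set \<Rightarrow> ('a \<Rightarrow> 'a) set) \<Rightarrow> 'a set set \<Rightarrow>
     ('a set \<Rightarrow> 'a set \<Rightarrow> 'a \<Rightarrow> 'a) \<Rightarrow> 'a set \<Rightarrow> ('a \<Rightarrow> 'a) set" where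
  "A_group S Qs \<A> V \<Theta> P =
     generate (Aut_group S P)
       (B_group S Qs \<A> V \<Theta> P \<union>
        {compose P (\<Theta> T P) (compose P (\<Theta> R T) (\<Theta> P R)) | R T.
           R \<in> graph_class S Qs \<A> V P - {P} \<and> T \<in> graph_class S Qs \<A> V P - {P}})"

end

theory Submission
  imports Defs
begin

text \<open>
  The generated fusion system \<open>\<F>(\<D>)\<close> is defined as an intersection, which says little about what
  its morphisms look like. Everything rests on an explicit description of them: every morphism is a
  finite composite of restrictions of members of the groups \<open>\<A>(Q)\<close>, followed by an inclusion.
  Such composites are closed under composition, inversion and restriction, and they contain the
  maps induced by conjugation in \<open>S\<close> because \<open>S\<close> itself is a member of the sequence; so they form
  a fusion system, clearly the smallest one (\<open>generated_fusion_eq\<close>). It is convenient to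
  keep only the bijective part: \<open>Iso P R\<close> is the set of composites that map \<open>P\<close> onto \<open>R\<close>, and these
  sets are the hom-sets of a groupoid on the subgroups of \<open>S\<close>.

  Part (i) then compares two ways to walk. A single factor \<open>\<mu> \<in> \<A>(Q)\<close> of a composite moves a
  subgroup \<open>T \<le> Q\<close> to \<open>T\<mu> \<le> Q\<close>, and this is an edge of the fusion graph between the orbit
  representatives of \<open>T\<close> and \<open>T\<mu>\<close>, unless these coincide. Conversely an edge, by definition,
  yields an element of \<open>Iso\<close>. So the components of the graph are the classes of the relation
  \<open>Iso P R \<noteq> {}\<close> (\<open>Iso_iff_component\<close>), and the maps \<open>\<Theta>\<close>, assembled from edge maps and elements of
  \<open>\<A>(S)\<close>, belong to \<open>Iso\<close> (\<open>theta_maps_Iso\<close>).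

  Part (ii) is the computation of a vertex group of a connected groupoid from generators of the
  groupoid and a choice of one arrow between any two objects. The idea is to close up an arbitrary
  composite \<open>\<phi> : P \<rightarrow> T\<close> to the loop \<open>\<phi>\<Theta>\<^bsub>T,P\<^esub>\<close> at \<open>P\<close> and to show by induction on the number of factors
  that this loop lies in \<open>A\<^sub>P\<close> (\<open>composite_A_group\<close>). Suppose that one more factor \<open>\<mu> : T \<rightarrow> U\<close> is added. The map
  \<open>\<psi> = \<Theta>\<^bsub>T,U\<^esub>\<mu>\<^sup>-\<^sup>1\<close> is a generator of \<open>C\<^sub>T\<close>, so \<open>\<mu> = \<psi>\<^sup>-\<^sup>1\<Theta>\<^bsub>T,U\<^esub>\<close> and, with maps written on the right,
  \<open>\<phi>\<mu>\<Theta>\<^bsub>U,P\<^esub> = (\<phi>\<Theta>\<^bsub>T,P\<^esub>) (\<Theta>\<^bsub>P,T\<^esub>\<psi>\<^sup>-\<^sup>1\<Theta>\<^bsub>T,P\<^esub>) (\<Theta>\<^bsub>P,T\<^esub>\<Theta>\<^bsub>T,U\<^esub>\<Theta>\<^bsub>U,P\<^esub>)\<close>. The three factors lie in \<open>A\<^sub>P\<close>, the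
  first by induction, the second because it is in \<open>B\<^sub>P\<close>, and the third because it is one of the
  triangles among the generators of \<open>A\<^sub>P\<close>, or the identity if \<open>P\<close> is \<open>T\<close> or \<open>U\<close>. The choices enter
  only through \<open>\<Theta>\<^bsub>X,Y\<^esub> \<in> Iso X Y\<close>, \<open>\<Theta>\<^bsub>Y,X\<^esub> = \<Theta>\<^bsub>X,Y\<^esub>\<^sup>-\<^sup>1\<close> and \<open>\<Theta>\<^bsub>X,X\<^esub> = 1\<close>. A loop \<open>\<phi> : P \<rightarrow> P\<close> is closed already,
  hence lies in \<open>A\<^sub>P\<close>.

  Part (iii) follows from (i) and (ii): \<open>C\<^sub>S(X) = Z(X)\<close> is invariant under automorphisms of \<open>S\<close>, so
  being \<open>\<F>\<close>-centric can be tested on the vertices of a component.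
\<close>

section \<open>Restricted bijections\<close>

lemma inv_map_extensional: "inv_map P \<phi> \<in> extensional (\<phi> ` P)"
  by (simp add: inv_map_def)

lemma inv_map_left: "inj_on \<phi> P \<Longrightarrow> x \<in> P \<Longrightarrow> inv_map P \<phi> (\<phi> x) = x"
  by (simp add: inv_map_def)

lemma inv_map_image: "inj_on \<phi> P \<Longrightarrow> inv_map P \<phi> ` \<phi> ` P = P"
  by (simp add: inv_map_def)

lemma inv_map_inj_on: "inj_on \<phi> P \<Longrightarrow> inj_on (inv_map P \<phi>) (\<phi> ` P)"
  by (rule inj_onI) (auto simp: inv_map_left)

lemma inv_map_eqI:
  assumes "inj_on \<phi> P" "\<phi> ` P = R" "\<psi> \<in> extensional R" "\<And>x. x \<in> P \<Longrightarrow> \<psi> (\<phi> x) = x"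
  shows "inv_map P \<phi> = \<psi>"
  using assms by (intro extensionalityI[where A = R]) (auto simp: inv_map_left inv_map_extensional)

lemma inv_map_inv_map:
  assumes "inj_on \<phi> P" "\<phi> \<in> extensional P"
  shows "inv_map (\<phi> ` P) (inv_map P \<phi>) = \<phi>"
  using assms by (intro inv_map_eqI) (auto simp: inv_map_left inv_map_inj_on inv_map_image)

lemma compose_image: "compose P \<psi> \<phi> ` P = \<psi> ` \<phi> ` P"
  by (auto simp: compose_def image_iff)

lemma compose_assoc_image:
  assumes "\<phi> ` P = T" shows "compose P (compose T \<chi> \<psi>) \<phi> = compose P \<chi> (compose P \<psi> \<phi>)"
  using assms by (auto simp: compose_def fun_eq_iff restrict_def)

lemma compose_id_left: "\<phi> \<in> extensional P \<Longrightarrow> \<phi> ` P \<subseteq> R \<Longrightarrow> compose P (\<lambda>x \<in> R. x) \<phi> = \<phi>"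
  by (rule extensionalityI[where A = P]) (auto simp: compose_def)

lemma compose_id_right: "compose P \<phi> (\<lambda>x \<in> P. x) = restrict \<phi> P"
  by (auto simp: compose_def)


section \<open>Automorphism groups of subgroups\<close>

context group
begin

lemma group_subgroup: "subgroup P G \<Longrightarrow> group (G\<lparr>carrier := P\<rparr>)"
  using subgroup.subgroup_is_group is_group by blast

lemma group_Aut_group: "subgroup P G \<Longrightarrow> group (Aut_group G P)"
  by (rule group.AutoGroup[OF group_subgroup])

lemma carrier_Aut_group:
  "carrier (Aut_group G P) =
     {\<phi>. \<phi> \<in> extensional P \<and> bij_betw \<phi> P P \<and> (\<forall>x \<in> P. \<forall>y \<in> P. \<phi> (x \<otimes> y) = \<phi> x \<otimes> \<phi> y)}"
  by (auto simp: AutoGroup_def auto_def hom_def Bij_def bij_betw_def)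

lemma mult_Aut_group:
  "\<phi> \<in> carrier (Aut_group G P) \<Longrightarrow> \<psi> \<in> carrier (Aut_group G P) \<Longrightarrow>
     \<phi> \<otimes>\<^bsub>Aut_group G P\<^esub> \<psi> = compose P \<phi> \<psi>"
  by (auto simp: AutoGroup_def auto_def BijGroup_def)

lemma one_Aut_group: "\<one>\<^bsub>Aut_group G P\<^esub> = (\<lambda>x \<in> P. x)"
  by (auto simp: AutoGroup_def BijGroup_def)

lemma inv_map_Aut_group:
  assumes P: "subgroup P G" and \<phi>: "\<phi> \<in> carrier (Aut_group G P)"
  shows "inv_map P \<phi> = inv\<^bsub>Aut_group G P\<^esub> \<phi>"
proof -
  interpret AG: group "Aut_group G P" by (rule group_Aut_group[OF P])
  have i: "inv\<^bsub>Aut_group G P\<^esub> \<phi> \<in> carrier (Aut_group G P)" using \<phi> by simp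
  have "compose P (inv\<^bsub>Aut_group G P\<^esub> \<phi>) \<phi> = (\<lambda>x \<in> P. x)"
    using mult_Aut_group[OF i \<phi>] AG.l_inv[OF \<phi>] one_Aut_group[of P] by simp
  then have "\<And>x. x \<in> P \<Longrightarrow> (inv\<^bsub>Aut_group G P\<^esub> \<phi>) (\<phi> x) = x"
    by (metis compose_eq restrict_apply')
  then show ?thesis
    using \<phi> i by (intro inv_map_eqI[where R = P]) (auto simp: carrier_Aut_group bij_betw_def)
qed

end


section \<open>The fusion system generated by a fusion datum\<close>

locale finite_fusion_datum = group S for S (structure) +
  fixes Qs :: "'a set list" and \<A> :: "'a set \<Rightarrow> ('a \<Rightarrow> 'a) set"
  assumes finite_S: "finite (carrier S)" and datum: "fusion_datum S Qs \<A>"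
begin

lemma subgroup_Q: "Q \<in> set Qs \<Longrightarrow> subgroup Q S"
  and S_in_Qs: "carrier S \<in> set Qs"
  and subgroup_\<A>: "Q \<in> set Qs \<Longrightarrow> subgroup (\<A> Q) (Aut_group S Q)"
  and Hom_S_\<A>: "Q \<in> set Qs \<Longrightarrow> Hom_S S Q Q \<subseteq> \<A> Q"
  using datum unfolding fusion_datum_def by (auto dest: hd_in_set)

lemma \<A>_carrier: "Q \<in> set Qs \<Longrightarrow> \<mu> \<in> \<A> Q \<Longrightarrow> \<mu> \<in> carrier (Aut_group S Q)"
  using subgroup.subset[OF subgroup_\<A>] by blast

lemma \<A>_extensional: "Q \<in> set Qs \<Longrightarrow> \<mu> \<in> \<A> Q \<Longrightarrow> \<mu> \<in> extensional Q"
  and \<A>_inj_on: "Q \<in> set Qs \<Longrightarrow> \<mu> \<in> \<A> Q \<Longrightarrow> inj_on \<mu> Q"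
  and \<A>_image: "Q \<in> set Qs \<Longrightarrow> \<mu> \<in> \<A> Q \<Longrightarrow> \<mu> ` Q = Q"
  and \<A>_mult: "Q \<in> set Qs \<Longrightarrow> \<mu> \<in> \<A> Q \<Longrightarrow> x \<in> Q \<Longrightarrow> y \<in> Q \<Longrightarrow> \<mu> (x \<otimes> y) = \<mu> x \<otimes> \<mu> y"
  using \<A>_carrier[of Q \<mu>] by (auto simp: carrier_Aut_group bij_betw_def)

lemma \<A>_id: "Q \<in> set Qs \<Longrightarrow> (\<lambda>x \<in> Q. x) \<in> \<A> Q"
  using subgroup.one_closed[OF subgroup_\<A>] by (simp add: one_Aut_group)

lemma \<A>_inv_map: "Q \<in> set Qs \<Longrightarrow> \<mu> \<in> \<A> Q \<Longrightarrow> inv_map Q \<mu> \<in> \<A> Q"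
  using subgroup.m_inv_closed[OF subgroup_\<A>] by (metis \<A>_carrier inv_map_Aut_group subgroup_Q)

text \<open>
  The domain of a composite is fixed while its image moves: each step applies an automorphism of
  some \<open>Q\<close> that contains the current image. Restriction of the next factor is thus
  built in, and inductions proceed along the path of images of \<open>P\<close>.
\<close>

inductive composite :: "'a set \<Rightarrow> ('a \<Rightarrow> 'a) \<Rightarrow> bool" for P where
  composite_id: "composite P (\<lambda>x \<in> P. x)"
| composite_step: "composite P \<phi> \<Longrightarrow> Q \<in> set Qs \<Longrightarrow> \<phi> ` P \<subseteq> Q \<Longrightarrow> \<mu> \<in> \<A> Q \<Longrightarrow>
     composite P (compose P \<mu> \<phi>)"

text \<open>
  The groupoid of isomorphisms of \<open>\<F>(\<D>)\<close>. Demanding equality of the image with \<open>R\<close> makes every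
  element invertible.
\<close>

definition Iso :: "'a maps" where
  "Iso P R = {\<phi>. subgroup P S \<and> composite P \<phi> \<and> \<phi> ` P = R}"

lemma subgroup_hom_image:
  assumes P: "subgroup P S" and im: "\<phi> ` P \<subseteq> carrier S"
    and m: "\<And>x y. x \<in> P \<Longrightarrow> y \<in> P \<Longrightarrow> \<phi> (x \<otimes> y) = \<phi> x \<otimes> \<phi> y"
  shows "subgroup (\<phi> ` P) S"
proof -
  have "\<phi> \<in> hom (S\<lparr>carrier := P\<rparr>) S"
    using im m by (auto simp: hom_def)
  then have "group_hom (S\<lparr>carrier := P\<rparr>) S \<phi>"
    using group_subgroup[OF P] is_group by (simp add: group_hom_def group_hom_axioms_def)
  from group_hom.img_is_subgroup[OF this] show ?thesis by simp
qed

lemma composite_props: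
  assumes "subgroup P S" "composite P \<phi>"
  shows "\<phi> \<in> extensional P \<and> inj_on \<phi> P \<and> \<phi> ` P \<subseteq> carrier S \<and>
    (\<forall>x \<in> P. \<forall>y \<in> P. \<phi> (x \<otimes> y) = \<phi> x \<otimes> \<phi> y)"
  using assms(2)
proof induction
  case composite_id
  have "P \<subseteq> carrier S" "\<And>x y. x \<in> P \<Longrightarrow> y \<in> P \<Longrightarrow> x \<otimes> y \<in> P"
    using subgroup.subset[OF assms(1)] subgroup.m_closed[OF assms(1)] by auto
  then have "inj_on (\<lambda>x \<in> P. x) P \<and> (\<lambda>x \<in> P. x) ` P \<subseteq> carrier S \<and>
      (\<forall>x \<in> P. \<forall>y \<in> P. (\<lambda>x \<in> P. x) (x \<otimes> y) = (\<lambda>x \<in> P. x) x \<otimes> (\<lambda>x \<in> P. x) y)"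
    by (auto simp: inj_on_def)
  then show ?case using restrict_extensional by blast
next
  case (composite_step \<phi> Q \<mu>)
  note \<mu> = \<open>Q \<in> set Qs\<close> \<open>\<mu> \<in> \<A> Q\<close> and sub = \<open>\<phi> ` P \<subseteq> Q\<close>
  have i: "inj_on \<phi> P" and m: "\<And>x y. x \<in> P \<Longrightarrow> y \<in> P \<Longrightarrow> \<phi> (x \<otimes> y) = \<phi> x \<otimes> \<phi> y"
    using composite_step.IH by auto
  have "inj_on \<mu> (\<phi> ` P)"
    using \<A>_inj_on[OF \<mu>] sub by (rule inj_on_subset)
  then have "inj_on (\<mu> \<circ> \<phi>) P"
    using i by (rule comp_inj_on[rotated])
  then have inj: "inj_on (compose P \<mu> \<phi>) P"
    by (simp add: compose_def inj_on_def)
  have "\<mu> ` \<phi> ` P \<subseteq> \<mu> ` Q" using sub by blast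
  then have im: "compose P \<mu> \<phi> ` P \<subseteq> carrier S"
    using \<A>_image[OF \<mu>] subgroup.subset[OF subgroup_Q[OF \<mu>(1)]] by (simp add: compose_image)
  have "compose P \<mu> \<phi> (x \<otimes> y) = compose P \<mu> \<phi> x \<otimes> compose P \<mu> \<phi> y" if "x \<in> P" "y \<in> P" for x y
  proof -
    have "x \<otimes> y \<in> P" using that subgroup.m_closed[OF assms(1)] by simp
    moreover have "\<phi> x \<in> Q" "\<phi> y \<in> Q" using that sub by auto
    ultimately show ?thesis
      using that m \<A>_mult[OF \<mu>] by (simp add: compose_eq)
  qed
  then show ?case using inj im compose_extensional by blast
qed

lemma Iso_extensional: "\<phi> \<in> Iso P R \<Longrightarrow> \<phi> \<in> extensional P"
  and Iso_inj_on: "\<phi> \<in> Iso P R \<Longrightarrow> inj_on \<phi> P"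
  and Iso_mult: "\<phi> \<in> Iso P R \<Longrightarrow> x \<in> P \<Longrightarrow> y \<in> P \<Longrightarrow> \<phi> (x \<otimes> y) = \<phi> x \<otimes> \<phi> y"
  and Iso_image: "\<phi> \<in> Iso P R \<Longrightarrow> \<phi> ` P = R"
  and Iso_dom: "\<phi> \<in> Iso P R \<Longrightarrow> subgroup P S"
  and Iso_composite: "\<phi> \<in> Iso P R \<Longrightarrow> composite P \<phi>"
  using composite_props unfolding Iso_def by auto

lemma composite_subgroup_image:
  assumes "subgroup P S" "composite P \<phi>" shows "subgroup (\<phi> ` P) S"
  using composite_props[OF assms] assms(1) by (intro subgroup_hom_image) auto

lemma Iso_cod: "\<phi> \<in> Iso P R \<Longrightarrow> subgroup R S"
  using composite_subgroup_image unfolding Iso_def by auto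

lemma Iso_id: "subgroup P S \<Longrightarrow> (\<lambda>x \<in> P. x) \<in> Iso P P"
  by (simp add: Iso_def composite_id)

lemma Iso_restrict:
  assumes "Q \<in> set Qs" "\<mu> \<in> \<A> Q" "T \<subseteq> Q" "subgroup T S"
  shows "restrict \<mu> T \<in> Iso T (\<mu> ` T)"
  using composite_step[OF composite_id assms(1) _ assms(2), of T] assms
  by (simp add: Iso_def compose_id_right)

lemma Iso_compose:
  assumes \<phi>: "\<phi> \<in> Iso P R" and \<psi>: "\<psi> \<in> Iso R T"
  shows "compose P \<psi> \<phi> \<in> Iso P T"
proof -
  have "composite P (compose P \<psi> \<phi>)"
    using Iso_composite[OF \<psi>]
  proof induction
    case composite_id
    have "compose P (\<lambda>x \<in> R. x) \<phi> = \<phi>"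
      using \<phi> by (intro compose_id_left) (auto simp: Iso_extensional Iso_image)
    then show ?case using Iso_composite[OF \<phi>] by metis
  next
    case (composite_step \<psi> Q \<mu>)
    have "composite P (compose P \<mu> (compose P \<psi> \<phi>))"
      by (rule composite.composite_step[OF composite_step(5,2) _ composite_step(4)])
        (use composite_step(3) Iso_image[OF \<phi>] in \<open>simp add: compose_image\<close>)
    then show ?case by (simp add: compose_assoc_image Iso_image[OF \<phi>])
  qed
  then show ?thesis using \<phi> \<psi> by (simp add: Iso_def compose_image)
qed

text \<open>
  The inverse of a composite is the composite of the inverse factors in reverse order, each of them
  restricted to the image that the composite has reached.
\<close>

lemma Iso_inv_map:
  assumes \<phi>: "\<phi> \<in> Iso P R"
  shows "inv_map P \<phi> \<in> Iso R P"
proof -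
  have P: "subgroup P S" using Iso_dom[OF \<phi>] .
  have "inv_map P \<phi> \<in> Iso (\<phi> ` P) P"
    using Iso_composite[OF \<phi>]
  proof induction
    case composite_id
    have "inv_map P (\<lambda>x \<in> P. x) = (\<lambda>x \<in> P. x)"
      by (rule inv_map_eqI) (auto simp: inj_on_def)
    moreover have "(\<lambda>x \<in> P. x) ` P = P" by auto
    ultimately show ?case using Iso_id[OF P] by metis
  next
    case (composite_step \<phi> Q \<mu>)
    let ?T = "\<phi> ` P" and ?U = "\<mu> ` \<phi> ` P"
    note \<mu> = \<open>Q \<in> set Qs\<close> \<open>\<mu> \<in> \<A> Q\<close>
    have T: "subgroup ?T S" and iP: "inj_on \<phi> P"
      using composite_subgroup_image[OF P] composite_props[OF P] composite_step by auto
    have r: "restrict \<mu> ?T \<in> Iso ?T ?U" using Iso_restrict composite_step T by blast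
    have inj: "inj_on \<mu> Q" using \<A>_inj_on \<mu> by blast
    have eq: "inv_map Q \<mu> (\<mu> x) = x" if "x \<in> Q" for x using inv_map_left[OF inj that] .
    have sub: "?U \<subseteq> Q" using \<A>_image[OF \<mu>] composite_step by blast
    have "inv_map Q \<mu> ` ?U = ?T" using composite_step eq by (force simp: image_image)
    then have b: "restrict (inv_map Q \<mu>) ?U \<in> Iso ?U ?T"
      using Iso_restrict[OF \<mu>(1) \<A>_inv_map[OF \<mu>] sub Iso_cod[OF r]] by simp
    have "inv_map P (compose P \<mu> \<phi>) = compose ?U (inv_map P \<phi>) (restrict (inv_map Q \<mu>) ?U)"
    proof (rule inv_map_eqI)
      show "inj_on (compose P \<mu> \<phi>) P"
        using composite_props[OF P composite.composite_step] composite_step by blast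
      show "compose P \<mu> \<phi> ` P = ?U" by (rule compose_image)
      fix x assume "x \<in> P"
      then show "compose ?U (inv_map P \<phi>) (restrict (inv_map Q \<mu>) ?U) (compose P \<mu> \<phi> x) = x"
        using eq[of "\<phi> x"] composite_step(3) iP by (auto simp: compose_def inv_map_left)
    qed simp
    then show ?case
      using Iso_compose[OF b composite_step(5)] by (simp add: compose_image)
  qed
  then show ?thesis by (simp add: Iso_image[OF \<phi>])
qed

lemma subgroup_finite: "subgroup P S \<Longrightarrow> finite P"
  by (rule finite_subset[OF subgroup.subset finite_S])

lemma Iso_nonempty_trans: "Iso P R \<noteq> {} \<Longrightarrow> Iso R T \<noteq> {} \<Longrightarrow> Iso P T \<noteq> {}"
  using Iso_compose by blast

lemma Iso_nonempty_sym: "Iso P R \<noteq> {} \<Longrightarrow> Iso R P \<noteq> {}"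
  using Iso_inv_map by blast

definition composite_maps :: "'a maps" where
  "composite_maps P R = {\<phi>. subgroup P S \<and> subgroup R S \<and> composite P \<phi> \<and> \<phi> ` P \<subseteq> R}"

lemma composite_maps_iff:
  "\<phi> \<in> composite_maps P R \<longleftrightarrow> subgroup R S \<and> (\<exists>T \<subseteq> R. \<phi> \<in> Iso P T)"
  unfolding composite_maps_def Iso_def by blast

lemma Iso_composite_maps: "\<phi> \<in> Iso P R \<Longrightarrow> \<phi> \<in> composite_maps P R"
  using Iso_cod by (auto simp: composite_maps_iff)

text \<open>
  Conjugation by an element of \<open>S\<close> is a restriction of an inner automorphism of \<open>S\<close>, and these lie in
  \<open>\<A>(S)\<close>. This is where it matters that \<open>S\<close> is a member of the sequence.
\<close>

lemma Hom_S_composite_maps: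
  assumes P: "subgroup P S" and R: "subgroup R S" and \<phi>: "\<phi> \<in> Hom_S S P R"
  shows "\<phi> \<in> composite_maps P R"
proof -
  obtain g where g: "g \<in> carrier S" "\<phi> = conj_map S P g" "conj_map S P g ` P \<subseteq> R"
    using \<phi> unfolding Hom_S_def by blast
  have PS: "P \<subseteq> carrier S" using P by (rule subgroup.subset)
  have "conj_map S (carrier S) g \<in> Hom_S S (carrier S) (carrier S)"
    unfolding Hom_S_def using g by (auto simp: conj_map_def)
  then have c: "conj_map S (carrier S) g \<in> \<A> (carrier S)" using Hom_S_\<A>[OF S_in_Qs] by blast
  have "restrict (conj_map S (carrier S) g) P = conj_map S P g"
    using PS by (auto simp: conj_map_def restrict_def fun_eq_iff)
  then have "conj_map S P g \<in> Iso P (conj_map S (carrier S) g ` P)"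
    using Iso_restrict[OF S_in_Qs c PS P] by simp
  then have "conj_map S P g \<in> Iso P (conj_map S P g ` P)"
    using Iso_image by metis
  then show ?thesis using g R by (auto simp: composite_maps_iff)
qed

text \<open>
  Here the image of \<open>\<phi>\<close> may be smaller than the domain of \<open>\<psi>\<close>, so \<open>\<psi>\<close> is first restricted, which
  restricts each of its factors.
\<close>

lemma composite_maps_compose:
  assumes \<phi>: "\<phi> \<in> composite_maps P Q" and \<psi>: "\<psi> \<in> composite_maps Q R"
  shows "compose P \<psi> \<phi> \<in> composite_maps P R"
proof -
  obtain T U where T: "T \<subseteq> Q" "\<phi> \<in> Iso P T" and U: "U \<subseteq> R" "\<psi> \<in> Iso Q U" and R: "subgroup R S"
    using assms by (auto simp: composite_maps_iff)
  have sT: "subgroup T S" using Iso_cod T by blast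
  have "composite T (restrict \<psi> T)"
    using Iso_composite[OF U(2)]
  proof induction
    case composite_id
    have "restrict (\<lambda>x \<in> Q. x) T = (\<lambda>x \<in> T. x)"
      using T by (intro extensionalityI[where A = T]) auto
    then show ?case using composite.composite_id by metis
  next
    case (composite_step \<psi> Q' \<mu>)
    have "composite T (compose T \<mu> (restrict \<psi> T))"
      by (rule composite.composite_step[OF composite_step(5,2)]) (use composite_step T in auto)
    moreover have "compose T \<mu> (restrict \<psi> T) = restrict (compose Q \<mu> \<psi>) T"
      using T by (auto simp: compose_def restrict_def fun_eq_iff)
    ultimately show ?case by metis
  qed
  then have "restrict \<psi> T \<in> Iso T (\<psi> ` T)" using sT by (simp add: Iso_def)
  then have "compose P (restrict \<psi> T) \<phi> \<in> Iso P (\<psi> ` T)" using Iso_compose T by blast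
  moreover have "compose P (restrict \<psi> T) \<phi> = compose P \<psi> \<phi>"
    using Iso_image[OF T(2)] by (auto simp: compose_def restrict_def fun_eq_iff)
  moreover have "\<psi> ` T \<subseteq> R" using T U Iso_image by blast
  ultimately show ?thesis using R by (auto simp: composite_maps_iff)
qed

lemma fusion_system_composite_maps: "fusion_system S composite_maps"
  unfolding fusion_system_def
proof (intro conjI allI impI ballI)
  fix P Q assume "\<not> (subgroup P S \<and> subgroup Q S)"
  then show "composite_maps P Q = {}" by (auto simp: composite_maps_def)
next
  fix P Q assume PQ: "subgroup P S \<and> subgroup Q S"
  then show "Hom_S S P Q \<subseteq> composite_maps P Q" using Hom_S_composite_maps by blast
  show "composite_maps P Q \<subseteq> Inj S P Q"
  proof
    fix \<phi> assume "\<phi> \<in> composite_maps P Q"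
    then show "\<phi> \<in> Inj S P Q"
      using composite_props[of P \<phi>] by (auto simp: composite_maps_def Inj_def mon_def hom_def)
  qed
next
  fix P Q R \<phi> \<psi> assume "\<phi> \<in> composite_maps P Q" "\<psi> \<in> composite_maps Q R"
  then show "compose P \<psi> \<phi> \<in> composite_maps P R" by (rule composite_maps_compose)
next
  fix P Q \<phi> assume "\<phi> \<in> composite_maps P Q"
  then obtain T where T: "\<phi> \<in> Iso P T" by (auto simp: composite_maps_iff)
  then show "\<phi> \<in> composite_maps P (\<phi> ` P)" "inv_map P \<phi> \<in> composite_maps (\<phi> ` P) P"
    using Iso_composite_maps Iso_inv_map Iso_image by blast+
qed

lemma \<A>_composite_maps: "Q \<in> set Qs \<Longrightarrow> \<A> Q \<subseteq> composite_maps Q Q"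
proof
  fix \<mu> assume Q: "Q \<in> set Qs" and \<mu>: "\<mu> \<in> \<A> Q"
  have "restrict \<mu> Q = \<mu>" using \<A>_extensional[OF Q \<mu>] extensional_restrict by blast
  then show "\<mu> \<in> composite_maps Q Q"
    using Iso_composite_maps[OF Iso_restrict[OF Q \<mu> _ subgroup_Q[OF Q]]] \<A>_image[OF Q \<mu>] by simp
qed

lemma inclusion_in_fusion_system:
  assumes F: "fusion_system S F" and P: "subgroup P S" and R: "subgroup R S" and "P \<subseteq> R"
  shows "(\<lambda>x \<in> P. x) \<in> F P R"
proof -
  have PS: "P \<subseteq> carrier S" using P by (rule subgroup.subset)
  have "conj_map S P \<one> = (\<lambda>x \<in> P. x)"
    using PS by (auto simp: conj_map_def restrict_def fun_eq_iff)
  then have "(\<lambda>x \<in> P. x) \<in> Hom_S S P R"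
    unfolding Hom_S_def using \<open>P \<subseteq> R\<close> by (intro CollectI exI[of _ \<one>]) auto
  then show ?thesis using F P R unfolding fusion_system_def by blast
qed

text \<open>
  A fusion system is closed under restriction and under enlarging the codomain because it contains
  the inclusions and is closed under composition. So it contains each step of a composite of maps
  that it contains.
\<close>

lemma composite_maps_least:
  assumes F: "fusion_system S F" and sub: "\<And>Q. Q \<in> set Qs \<Longrightarrow> \<A> Q \<subseteq> F Q Q"
  shows "composite_maps P R \<subseteq> F P R"
proof
  have comp: "\<And>P Q R \<phi> \<psi>. \<phi> \<in> F P Q \<Longrightarrow> \<psi> \<in> F Q R \<Longrightarrow> compose P \<psi> \<phi> \<in> F P R"
    and im: "\<And>P Q \<phi>. \<phi> \<in> F P Q \<Longrightarrow> \<phi> \<in> F P (\<phi> ` P)"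
    using F unfolding fusion_system_def by blast+
  fix \<phi> assume \<phi>: "\<phi> \<in> composite_maps P R"
  then have P: "subgroup P S" and R: "subgroup R S" and sR: "\<phi> ` P \<subseteq> R"
    and c: "composite P \<phi>" by (auto simp: composite_maps_def)
  have enlarge: "\<phi> \<in> F P T" if "\<phi> \<in> F P U" "composite P \<phi>" "\<phi> ` P \<subseteq> T" "subgroup T S" for \<phi> T U
  proof -
    have "compose P (\<lambda>x \<in> \<phi> ` P. x) \<phi> \<in> F P T"
      using comp[OF im[OF that(1)] inclusion_in_fusion_system[OF F _ that(4,3)]]
        composite_subgroup_image[OF P that(2)] by blast
    then show ?thesis
      using compose_id_left[of \<phi> P "\<phi> ` P"] composite_props[OF P that(2)] by simp
  qed
  have "\<exists>U. \<phi> \<in> F P U"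
    using c
  proof induction
    case composite_id
    then show ?case using inclusion_in_fusion_system[OF F P P] by blast
  next
    case (composite_step \<phi> Q \<mu>)
    then have "\<phi> \<in> F P Q" using enlarge subgroup_Q by blast
    then show ?case using comp sub composite_step by blast
  qed
  then show "\<phi> \<in> F P R" using enlarge c sR R by blast
qed

theorem generated_fusion_eq: "generated_fusion S Qs \<A> = composite_maps"
proof (intro ext equalityI)
  fix P R
  show "generated_fusion S Qs \<A> P R \<subseteq> composite_maps P R"
    unfolding generated_fusion_def using fusion_system_composite_maps \<A>_composite_maps by blast
  show "composite_maps P R \<subseteq> generated_fusion S Qs \<A> P R"
    unfolding generated_fusion_def using composite_maps_least by blast
qed

text \<open>
  An injective map of the finite group \<open>P\<close> into itself is onto, so endomorphisms are automorphisms.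
\<close>

lemma generated_fusion_Aut:
  assumes P: "subgroup P S"
  shows "generated_fusion S Qs \<A> P P = Iso P P"
proof -
  have "\<phi> ` P = P" if "composite P \<phi>" "\<phi> ` P \<subseteq> P" for \<phi>
    using endo_inj_surj[OF subgroup_finite[OF P] that(2)] composite_props[OF P that(1)] by blast
  then show ?thesis
    using P unfolding generated_fusion_eq composite_maps_def Iso_def by blast
qed

lemma conj_class_iff:
  "R \<in> conj_class S (generated_fusion S Qs \<A>) P \<longleftrightarrow> Iso P R \<noteq> {}"
proof
  assume "R \<in> conj_class S (generated_fusion S Qs \<A>) P"
  then obtain \<alpha> T where "R = \<alpha> ` P" "\<alpha> \<in> Iso P T"
    unfolding conj_class_def generated_fusion_eq composite_maps_iff by blast
  then show "Iso P R \<noteq> {}" using Iso_image by blast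
next
  assume "Iso P R \<noteq> {}"
  then obtain \<alpha> where \<alpha>: "\<alpha> \<in> Iso P R" by blast
  then have "\<alpha> \<in> composite_maps P (carrier S)"
    using subgroup.subset[OF Iso_cod[OF \<alpha>]] subgroup_self by (auto simp: composite_maps_iff)
  then show "R \<in> conj_class S (generated_fusion S Qs \<A>) P"
    using Iso_image[OF \<alpha>] unfolding conj_class_def generated_fusion_eq by blast
qed

lemma Iso_self_carrier: "Iso P P \<subseteq> carrier (Aut_group S P)"
  using Iso_extensional Iso_inj_on Iso_image Iso_mult
  by (fastforce simp: carrier_Aut_group bij_betw_def)

lemma subgroup_Iso_self:
  assumes P: "subgroup P S" shows "subgroup (Iso P P) (Aut_group S P)"
proof -
  interpret AG: group "Aut_group S P" by (rule group_Aut_group[OF P])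
  show ?thesis
  proof (rule AG.subgroupI)
    show "Iso P P \<subseteq> carrier (Aut_group S P)" by (rule Iso_self_carrier)
    show "Iso P P \<noteq> {}" using Iso_id[OF P] by blast
    show "inv\<^bsub>Aut_group S P\<^esub> \<phi> \<in> Iso P P" if "\<phi> \<in> Iso P P" for \<phi>
      using that Iso_inv_map inv_map_Aut_group[OF P, of \<phi>] Iso_self_carrier[of P] by force
    show "\<phi> \<otimes>\<^bsub>Aut_group S P\<^esub> \<psi> \<in> Iso P P" if "\<phi> \<in> Iso P P" "\<psi> \<in> Iso P P" for \<phi> \<psi>
      using that Iso_compose[of \<psi> P P \<phi> P] mult_Aut_group[of \<phi> P \<psi>] Iso_self_carrier[of P] by force
  qed
qed

end


section \<open>The fusion graph\<close>

locale finite_fusion_graph = finite_fusion_datum S Qs \<A>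
  for S (structure) and Qs :: "'a set list" and \<A> :: "'a set \<Rightarrow> ('a \<Rightarrow> 'a) set" +
  fixes V :: "'a set set"
  assumes reps: "orbit_reps S Qs \<A> V"
begin

lemma V_subgroup: "X \<in> V \<Longrightarrow> subgroup X S"
  and Qs_V: "Q \<in> set Qs \<Longrightarrow> Q \<in> V"
  and ex1_rep: "subgroup X S \<Longrightarrow> \<exists>!R. R \<in> V \<and> (\<exists>\<alpha> \<in> \<A> (carrier S). R = \<alpha> ` X)"
  using reps unfolding orbit_reps_def by auto

lemma ambient_Iso: "\<alpha> \<in> \<A> (carrier S) \<Longrightarrow> subgroup X S \<Longrightarrow> restrict \<alpha> X \<in> Iso X (\<alpha> ` X)"
  by (rule Iso_restrict[OF S_in_Qs _ subgroup.subset])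

lemma ambient_inv_image:
  assumes "\<alpha> \<in> \<A> (carrier S)" "X \<subseteq> carrier S"
  shows "inv_map (carrier S) \<alpha> ` \<alpha> ` X = X"
proof -
  have "inv_map (carrier S) \<alpha> (\<alpha> x) = x" if "x \<in> X" for x
    using inv_map_left[OF \<A>_inj_on[OF S_in_Qs assms(1)]] that assms(2) by blast
  then show ?thesis by (simp add: image_image)
qed

lemma ambient_inv_Iso:
  assumes "\<alpha> \<in> \<A> (carrier S)" "subgroup X S"
  shows "restrict (inv_map (carrier S) \<alpha>) (\<alpha> ` X) \<in> Iso (\<alpha> ` X) X"
  using ambient_Iso[OF \<A>_inv_map[OF S_in_Qs assms(1)] Iso_cod[OF ambient_Iso[OF assms]]]
    ambient_inv_image[OF assms(1) subgroup.subset[OF assms(2)]] by simp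

lemma rep_in_V: "subgroup X S \<Longrightarrow> rep S \<A> V X \<in> V"
  and rep_image: "subgroup X S \<Longrightarrow> \<exists>\<alpha> \<in> \<A> (carrier S). rep S \<A> V X = \<alpha> ` X"
  using theI'[OF ex1_rep, of X] unfolding rep_def by auto

lemma rep_eqI:
  assumes "subgroup X S" "\<alpha> \<in> \<A> (carrier S)" "\<alpha> ` X \<in> V"
  shows "rep S \<A> V X = \<alpha> ` X"
  using ex1_rep[OF assms(1)] rep_in_V[OF assms(1)] rep_image[OF assms(1)] assms(2,3) by blast

lemma rep_vertex:
  assumes X: "X \<in> V" shows "rep S \<A> V X = X"
proof -
  have "(\<lambda>x \<in> carrier S. x) ` X = X" using subgroup.subset[OF V_subgroup[OF X]] by force
  then show ?thesis using rep_eqI[OF V_subgroup[OF X] \<A>_id[OF S_in_Qs]] X by metis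
qed

lemma subgroup_rep: "subgroup X S \<Longrightarrow> subgroup (rep S \<A> V X) S"
  using V_subgroup rep_in_V by blast

lemma image_rep:
  assumes X: "subgroup X S" shows "\<exists>\<beta> \<in> \<A> (carrier S). X = \<beta> ` rep S \<A> V X"
proof -
  obtain \<alpha> where \<alpha>: "\<alpha> \<in> \<A> (carrier S)" "rep S \<A> V X = \<alpha> ` X" using rep_image[OF X] by blast
  then show ?thesis
    using \<A>_inv_map[OF S_in_Qs \<alpha>(1)] ambient_inv_image[OF \<alpha>(1) subgroup.subset[OF X]]
    by metis
qed

lemma rep_ambient_image:
  assumes X: "X \<in> V" and \<beta>: "\<beta> \<in> \<A> (carrier S)"
  shows "rep S \<A> V (\<beta> ` X) = X"
proof -
  have "inv_map (carrier S) \<beta> ` \<beta> ` X = X"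
    by (rule ambient_inv_image[OF \<beta> subgroup.subset[OF V_subgroup[OF X]]])
  then show ?thesis
    using rep_eqI[OF Iso_cod[OF ambient_Iso[OF \<beta> V_subgroup[OF X]]] \<A>_inv_map[OF S_in_Qs \<beta>]] X
    by simp
qed

lemma edge_vertices:
  assumes "{X, Y} \<in> fusion_graph_edges S Qs \<A> V" shows "X \<in> V" "Y \<in> V" "X \<noteq> Y"
  using assms unfolding fusion_graph_edges_def by (auto simp: doubleton_eq_iff)

text \<open>
  All three factors of an edge map are restrictions of elements of \<open>\<A>(S)\<close> or \<open>\<A>(Q)\<close>.
\<close>

lemma edge_data_Iso:
  assumes e: "edge_data S Qs \<A> R T \<alpha> Q \<beta> \<gamma>" and R: "subgroup R S" and T: "subgroup T S"
  shows "(\<lambda>x \<in> R. inv_into (carrier S) \<gamma> (\<beta> (\<alpha> x))) \<in> Iso R T"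
proof -
  have d: "\<alpha> \<in> \<A> (carrier S)" "\<gamma> \<in> \<A> (carrier S)" "Q \<in> set Qs" "\<beta> \<in> \<A> Q"
    "\<alpha> ` R \<subseteq> Q" "\<beta> ` \<alpha> ` R = \<gamma> ` T"
    using e by (auto simp: edge_data_def)
  have a: "restrict \<alpha> R \<in> Iso R (\<alpha> ` R)" by (rule ambient_Iso[OF d(1) R])
  have b: "restrict \<beta> (\<alpha> ` R) \<in> Iso (\<alpha> ` R) (\<gamma> ` T)"
    using Iso_restrict[OF d(3,4,5) Iso_cod[OF a]] d(6) by simp
  have c: "restrict (inv_map (carrier S) \<gamma>) (\<gamma> ` T) \<in> Iso (\<gamma> ` T) T"
    by (rule ambient_inv_Iso[OF d(2) T])
  have "compose R (restrict (inv_map (carrier S) \<gamma>) (\<gamma> ` T)) (compose R (restrict \<beta> (\<alpha> ` R)) (restrict \<alpha> R))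
    = (\<lambda>x \<in> R. inv_into (carrier S) \<gamma> (\<beta> (\<alpha> x)))" (is "?l = ?r")
  proof (rule extensionalityI[where A = R])
    fix x assume x: "x \<in> R"
    then have "\<beta> (\<alpha> x) \<in> \<gamma> ` T" using d(6) by blast
    moreover have "\<gamma> ` T \<subseteq> \<gamma> ` carrier S" by (rule image_mono[OF subgroup.subset[OF T]])
    ultimately show "?l x = ?r x" using x by (simp add: compose_def inv_map_def subsetD)
  qed auto
  then show ?thesis using Iso_compose[OF Iso_compose[OF a b] c] by simp
qed

lemma edgeI:
  assumes "edge_data S Qs \<A> R T \<alpha> Q \<beta> \<gamma>" "R \<in> V" "T \<in> V" "R \<noteq> T"
  shows "{R, T} \<in> fusion_graph_edges S Qs \<A> V"
  unfolding fusion_graph_edges_def using assms by (intro CollectI exI conjI) (rule refl | assumption)+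

lemma edge_Iso:
  assumes "{X, Y} \<in> fusion_graph_edges S Qs \<A> V" shows "Iso X Y \<noteq> {}"
proof -
  obtain R T \<alpha> Q \<beta> \<gamma> where RT: "{X, Y} = {R, T}" "R \<in> V" "T \<in> V" "edge_data S Qs \<A> R T \<alpha> Q \<beta> \<gamma>"
    using assms unfolding fusion_graph_edges_def by (elim CollectE exE conjE)
  from edge_data_Iso[OF RT(4) V_subgroup[OF RT(2)] V_subgroup[OF RT(3)]]
  have "Iso R T \<noteq> {}" by blast
  moreover from this have "Iso T R \<noteq> {}" by (rule Iso_nonempty_sym)
  ultimately show ?thesis using RT(1) unfolding doubleton_eq_iff by blast
qed

lemma component_step:
  assumes "Y \<in> component V E X" "{Y, Z} \<in> E" "Z \<in> V" shows "Z \<in> component V E X"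
  using assms rtrancl.rtrancl_into_rtrancl[of X Y "{(x, y). {x, y} \<in> E}" Z]
  by (simp add: component_def)

lemma component_Iso:
  assumes X: "X \<in> V" and Y: "Y \<in> fusion_component S Qs \<A> V X"
  shows "Iso X Y \<noteq> {}"
proof -
  have "(X, Y) \<in> {(x, y). {x, y} \<in> fusion_graph_edges S Qs \<A> V}\<^sup>*"
    using Y by (simp add: component_def)
  then show ?thesis
  proof induction
    case base
    then show ?case using Iso_id[OF V_subgroup[OF X]] by blast
  next
    case (step Y Z)
    then show ?case using edge_Iso[of Y Z] Iso_nonempty_trans by simp
  qed
qed

text \<open>
  Each step of a composite either stays in an \<open>\<A>(S)\<close>-orbit or crosses one edge.
\<close>

lemma composite_component:
  assumes P: "subgroup P S" and "composite P \<phi>"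
  shows "rep S \<A> V (\<phi> ` P) \<in> fusion_component S Qs \<A> V (rep S \<A> V P)"
  using assms(2)
proof induction
  case composite_id
  have "(\<lambda>x \<in> P. x) ` P = P" by auto
  then show ?case using rep_in_V[OF P] unfolding component_def by simp
next
  case (composite_step \<phi> Q \<mu>)
  \<comment> \<open>The last factor \<open>\<mu>\<close> moves \<open>T\<close> to \<open>U\<close> inside \<open>Q\<close>; carrying the representatives onto \<open>T\<close> and
    \<open>U\<close> by elements of \<open>\<A>(S)\<close> exhibits the edge between them.\<close>
  define T U where "T = \<phi> ` P" and "U = \<mu> ` T"
  note \<mu> = \<open>Q \<in> set Qs\<close> \<open>\<mu> \<in> \<A> Q\<close>
  have T: "subgroup T S" unfolding T_def using composite_subgroup_image[OF P] composite_step by blast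
  have TQ: "T \<subseteq> Q" unfolding T_def using composite_step by blast
  have U: "subgroup U S" unfolding U_def using Iso_cod[OF Iso_restrict[OF \<mu> TQ T]] .
  have UQ: "U \<subseteq> Q" unfolding U_def using TQ \<A>_image[OF \<mu>] by blast
  obtain \<alpha> \<gamma> where \<alpha>: "\<alpha> \<in> \<A> (carrier S)" "T = \<alpha> ` rep S \<A> V T"
    and \<gamma>: "\<gamma> \<in> \<A> (carrier S)" "U = \<gamma> ` rep S \<A> V U"
    using image_rep[OF T] image_rep[OF U] by blast
  have "edge_data S Qs \<A> (rep S \<A> V T) (rep S \<A> V U) \<alpha> Q \<mu> \<gamma>"
    unfolding edge_data_def using \<alpha> \<gamma> \<mu> TQ UQ U_def by metis
  then have "rep S \<A> V T = rep S \<A> V U \<or>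
      {rep S \<A> V T, rep S \<A> V U} \<in> fusion_graph_edges S Qs \<A> V"
    using edgeI[OF _ rep_in_V[OF T] rep_in_V[OF U]] by metis
  moreover have "rep S \<A> V T \<in> fusion_component S Qs \<A> V (rep S \<A> V P)"
    unfolding T_def by (rule composite_step.IH)
  ultimately have "rep S \<A> V U \<in> fusion_component S Qs \<A> V (rep S \<A> V P)"
    using component_step rep_in_V[OF U] by metis
  then show ?case by (simp add: compose_image U_def T_def)
qed

theorem Iso_iff_component:
  assumes P: "subgroup P S" and R: "subgroup R S"
  shows "Iso P R \<noteq> {} \<longleftrightarrow> rep S \<A> V R \<in> fusion_component S Qs \<A> V (rep S \<A> V P)"
proof
  assume "Iso P R \<noteq> {}"
  then show "rep S \<A> V R \<in> fusion_component S Qs \<A> V (rep S \<A> V P)"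
    using composite_component[OF P] Iso_composite Iso_image by fastforce
next
  assume "rep S \<A> V R \<in> fusion_component S Qs \<A> V (rep S \<A> V P)"
  then have "Iso (rep S \<A> V P) (rep S \<A> V R) \<noteq> {}"
    using component_Iso[OF rep_in_V[OF P]] by blast
  moreover obtain \<alpha> where "\<alpha> \<in> \<A> (carrier S)" "rep S \<A> V P = \<alpha> ` P" using rep_image[OF P] by blast
  then have "Iso P (rep S \<A> V P) \<noteq> {}" using ambient_Iso[OF _ P] by (metis empty_iff)
  moreover obtain \<beta> where "\<beta> \<in> \<A> (carrier S)" "R = \<beta> ` rep S \<A> V R" using image_rep[OF R] by blast
  then have "Iso (rep S \<A> V R) R \<noteq> {}" using ambient_Iso[OF _ subgroup_rep[OF R]] by (metis empty_iff)
  ultimately show "Iso P R \<noteq> {}" using Iso_nonempty_trans by metis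
qed

text \<open>
  The class read off from the graph is the conjugacy class: by the preceding theorem a component
  consists of the representatives of the subgroups isomorphic to \<open>P\<close>, and \<open>\<A>(S)\<close> carries them
  to all such subgroups.
\<close>

theorem graph_class_eq:
  assumes P: "subgroup P S"
  shows "graph_class S Qs \<A> V P = {T. Iso P T \<noteq> {}}"
proof (intro equalityI subsetI)
  fix T assume "T \<in> graph_class S Qs \<A> V P"
  then obtain X \<beta> where T: "T = \<beta> ` X" and \<beta>: "\<beta> \<in> \<A> (carrier S)"
    and X: "X \<in> fusion_component S Qs \<A> V (rep S \<A> V P)"
    unfolding graph_class_def by blast
  have XV: "X \<in> V" using X by (simp add: component_def)
  have "subgroup T S" unfolding T using Iso_cod[OF ambient_Iso[OF \<beta> V_subgroup[OF XV]]] .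
  then show "T \<in> {T. Iso P T \<noteq> {}}"
    using Iso_iff_component[OF P] rep_ambient_image[OF XV \<beta>] X T by simp
next
  fix T assume "T \<in> {T. Iso P T \<noteq> {}}"
  then have c: "Iso P T \<noteq> {}" and T: "subgroup T S" using Iso_cod by auto
  then show "T \<in> graph_class S Qs \<A> V P"
    using Iso_iff_component[OF P T] image_rep[OF T] unfolding graph_class_def by auto
qed

text \<open>
  An automorphism of \<open>S\<close> carries the centralizer and the center of \<open>X\<close> to those of its image.
\<close>

lemma centric_ambient_image:
  assumes \<alpha>: "\<alpha> \<in> \<A> (carrier S)" and X: "X \<subseteq> carrier S"
  shows "centric S (\<alpha> ` X) \<longleftrightarrow> centric S X"
proof -
  have inj: "inj_on \<alpha> (carrier S)" and im: "\<alpha> ` carrier S = carrier S"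
    using \<A>_inj_on \<A>_image S_in_Qs \<alpha> by auto
  have comm: "\<alpha> x \<otimes> \<alpha> y = \<alpha> y \<otimes> \<alpha> x \<longleftrightarrow> x \<otimes> y = y \<otimes> x"
    if "x \<in> carrier S" "y \<in> carrier S" for x y
  proof -
    have "\<alpha> (x \<otimes> y) = \<alpha> (y \<otimes> x) \<longleftrightarrow> x \<otimes> y = y \<otimes> x"
      using that by (intro inj_on_eq_iff[OF inj]) auto
    then show ?thesis using that \<A>_mult[OF S_in_Qs \<alpha>] by simp
  qed
  have cs: "centralizer S X \<subseteq> carrier S" "center (S\<lparr>carrier := X\<rparr>) \<subseteq> carrier S"
    using X by (auto simp: centralizer_def center_def)
  have "y \<in> centralizer S (\<alpha> ` X) \<longleftrightarrow> y \<in> \<alpha> ` centralizer S X" for y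
  proof -
    have "y \<in> centralizer S (\<alpha> ` X) \<longleftrightarrow> y \<in> \<alpha> ` carrier S \<and> (\<forall>z \<in> X. y \<otimes> \<alpha> z = \<alpha> z \<otimes> y)"
      by (simp add: centralizer_def im)
    also have "\<dots> \<longleftrightarrow> (\<exists>x \<in> carrier S. y = \<alpha> x \<and> (\<forall>z \<in> X. x \<otimes> z = z \<otimes> x))"
      using comm X by blast
    also have "\<dots> \<longleftrightarrow> y \<in> \<alpha> ` centralizer S X"
      by (auto simp: centralizer_def)
    finally show ?thesis .
  qed
  then have a: "centralizer S (\<alpha> ` X) = \<alpha> ` centralizer S X" by blast
  have "y \<in> center (S\<lparr>carrier := \<alpha> ` X\<rparr>) \<longleftrightarrow> y \<in> \<alpha> ` center (S\<lparr>carrier := X\<rparr>)" for y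
  proof -
    have "y \<in> center (S\<lparr>carrier := \<alpha> ` X\<rparr>) \<longleftrightarrow> y \<in> \<alpha> ` X \<and> (\<forall>z \<in> X. y \<otimes> \<alpha> z = \<alpha> z \<otimes> y)"
      by (simp add: center_def)
    also have "\<dots> \<longleftrightarrow> (\<exists>x \<in> X. y = \<alpha> x \<and> (\<forall>z \<in> X. x \<otimes> z = z \<otimes> x))"
      using comm X by blast
    also have "\<dots> \<longleftrightarrow> y \<in> \<alpha> ` center (S\<lparr>carrier := X\<rparr>)"
      by (auto simp: center_def)
    finally show ?thesis .
  qed
  then have b: "center (S\<lparr>carrier := \<alpha> ` X\<rparr>) = \<alpha> ` center (S\<lparr>carrier := X\<rparr>)" by blast
  show ?thesis unfolding centric_def a b using inj_on_image_eq_iff[OF inj cs] .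
qed

text \<open>
  Each member of the conjugacy class of \<open>Q\<close> differs by an automorphism of \<open>S\<close> from a vertex of the
  component, which is itself a member.
\<close>

theorem fusion_centric_iff_component:
  assumes Q: "Q \<in> V"
  shows "fusion_centric S (generated_fusion S Qs \<A>) Q \<longleftrightarrow>
    (\<forall>X \<in> fusion_component S Qs \<A> V Q. centric S X)"
proof
  assume l: "fusion_centric S (generated_fusion S Qs \<A>) Q"
  show "\<forall>X \<in> fusion_component S Qs \<A> V Q. centric S X"
    using l component_Iso[OF Q] by (simp add: fusion_centric_def Ball_def conj_class_iff)
next
  assume r: "\<forall>X \<in> fusion_component S Qs \<A> V Q. centric S X"
  show "fusion_centric S (generated_fusion S Qs \<A>) Q"
    unfolding fusion_centric_def
  proof
    fix R assume "R \<in> conj_class S (generated_fusion S Qs \<A>) Q"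
    then have i: "Iso Q R \<noteq> {}" by (simp add: conj_class_iff)
    then have R: "subgroup R S" using Iso_cod by blast
    have c: "centric S (rep S \<A> V R)"
      using Iso_iff_component[OF V_subgroup[OF Q] R] i rep_vertex[OF Q] r by simp
    obtain \<alpha> where "\<alpha> \<in> \<A> (carrier S)" "rep S \<A> V R = \<alpha> ` R" using rep_image[OF R] by blast
    then show "centric S R" using centric_ambient_image[OF _ subgroup.subset[OF R]] c by metis
  qed
qed


subsection \<open>The maps \<open>\<Theta>\<close>\<close>

lemma edge_maps_Iso:
  assumes \<theta>: "edge_maps S Qs \<A> V \<theta>" and e: "{X, Y} \<in> fusion_graph_edges S Qs \<A> V"
  shows "\<theta> X Y \<in> Iso X Y"
proof -
  obtain R T \<alpha> Q \<beta> \<gamma> where RT: "{X, Y} = {R, T}" and d: "edge_data S Qs \<A> R T \<alpha> Q \<beta> \<gamma>"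
    and \<theta>RT: "\<theta> R T = (\<lambda>x \<in> R. inv_into (carrier S) \<gamma> (\<beta> (\<alpha> x)))"
    and \<theta>TR: "\<theta> T R = inv_map R (\<theta> R T)"
    using bspec[OF \<theta>[unfolded edge_maps_def] e] by (elim exE conjE)
  have R: "subgroup R S" and T: "subgroup T S"
    using RT edge_vertices[OF e] V_subgroup by (auto simp: doubleton_eq_iff)
  have i: "\<theta> R T \<in> Iso R T" unfolding \<theta>RT by (rule edge_data_Iso[OF d R T])
  moreover have "\<theta> T R \<in> Iso T R" unfolding \<theta>TR by (rule Iso_inv_map[OF i])
  ultimately show ?thesis using RT by (auto simp: doubleton_eq_iff)
qed

lemma path_map_Iso:
  assumes \<theta>: "edge_maps S Qs \<A> V \<theta>"
  shows "xs \<noteq> [] \<Longrightarrow> set xs \<subseteq> V \<Longrightarrow>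
    successively (\<lambda>x y. {x, y} \<in> fusion_graph_edges S Qs \<A> V) xs \<Longrightarrow>
    path_map \<theta> xs \<in> Iso (hd xs) (last xs)"
proof (induction xs)
  case (Cons X xs)
  show ?case
  proof (cases xs)
    case Nil
    then show ?thesis using Iso_id[OF V_subgroup, of X] Cons.prems by (simp del: restrict_apply)
  next
    case (Cons Y ys)
    then have "path_map \<theta> xs \<in> Iso Y (last xs)" "\<theta> X Y \<in> Iso X Y"
      using Cons.IH Cons.prems edge_maps_Iso[OF \<theta>] by simp_all
    then show ?thesis using Iso_compose Cons by simp
  qed
qed simp

lemma vertex_maps_Iso:
  assumes \<theta>: "edge_maps S Qs \<A> V \<theta>" and \<Theta>: "vertex_maps S Qs \<A> V \<theta> \<Theta>"
    and X: "X \<in> V" and Y: "Y \<in> fusion_component S Qs \<A> V X"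
  shows "\<Theta> X Y \<in> Iso X Y"
proof (cases "X = Y")
  case True
  then show ?thesis using \<Theta> X Iso_id[OF V_subgroup[OF X]] unfolding vertex_maps_def by metis
next
  case False
  then obtain R T xs where RT: "{X, Y} = {R, T}"
    and xs: "graph_path V (fusion_graph_edges S Qs \<A> V) R xs T" "\<Theta> R T = path_map \<theta> xs"
    and TR: "\<Theta> T R = inv_map R (\<Theta> R T)"
    using \<Theta> X Y unfolding vertex_maps_def by metis
  have i: "\<Theta> R T \<in> Iso R T"
    using path_map_Iso[OF \<theta>, of xs] xs unfolding graph_path_def by metis
  moreover have "\<Theta> T R \<in> Iso T R" unfolding TR by (rule Iso_inv_map[OF i])
  ultimately show ?thesis using RT by (metis doubleton_eq_iff)
qed

lemma subgroup_map_Iso: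
  assumes \<phi>: "\<phi> \<in> Iso X Y"
    and \<beta>: "\<beta> \<in> \<A> (carrier S)" and RX: "R = \<beta> ` X"
    and \<delta>: "\<delta> \<in> \<A> (carrier S)" and TY: "T = \<delta> ` Y"
  shows "(\<lambda>x \<in> R. \<delta> (\<phi> (inv_into (carrier S) \<beta> x))) \<in> Iso R T"
proof -
  have X: "subgroup X S" and Y: "subgroup Y S" using Iso_dom[OF \<phi>] Iso_cod[OF \<phi>] by auto
  have a: "restrict (inv_map (carrier S) \<beta>) R \<in> Iso R X"
    using ambient_inv_Iso[OF \<beta> X] RX by simp
  have c: "restrict \<delta> Y \<in> Iso Y T"
    using ambient_Iso[OF \<delta> Y] TY by simp
  have "compose R (restrict \<delta> Y) (compose R \<phi> (restrict (inv_map (carrier S) \<beta>) R)) =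
      (\<lambda>x \<in> R. \<delta> (\<phi> (inv_into (carrier S) \<beta> x)))" (is "?l = ?r")
  proof (rule extensionalityI[where A = R])
    fix x assume x: "x \<in> R"
    then have "x \<in> \<beta> ` carrier S" using RX subgroup.subset[OF X] by blast
    then have "inv_map (carrier S) \<beta> x = inv_into (carrier S) \<beta> x" by (simp add: inv_map_def)
    moreover have "inv_map (carrier S) \<beta> x \<in> X" using x Iso_image[OF a] by auto
    then have "\<phi> (inv_map (carrier S) \<beta> x) \<in> Y" using Iso_image[OF \<phi>] by blast
    ultimately show "?l x = ?r x" using x by (simp add: compose_def)
  qed auto
  then show ?thesis
    using Iso_compose[OF Iso_compose[OF a \<phi>] c] by simp
qed

text \<open>
  Each stage of the construction composes elements of \<open>Iso\<close>. It fixes \<open>\<Theta>\<close>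
  for one of the two orientations of a pair and takes the inverse for the other; since
  inversion is an involution, the resulting relation between \<open>\<Theta>\<^bsub>X,Y\<^esub>\<close> and \<open>\<Theta>\<^bsub>Y,X\<^esub>\<close> no longer depends
  on the orientation.
\<close>

theorem theta_maps_Iso:
  assumes \<Theta>: "theta_maps S Qs \<A> V \<Theta>" and XY: "Iso X Y \<noteq> {}"
  shows "\<Theta> X Y \<in> Iso X Y \<and> \<Theta> Y X = inv_map X (\<Theta> X Y)"
proof -
  obtain \<theta> \<Theta>' where \<theta>: "edge_maps S Qs \<A> V \<theta>" and \<Theta>': "vertex_maps S Qs \<A> V \<theta> \<Theta>'"
    and sub: "subgroup_maps S Qs \<A> V \<Theta>' \<Theta>"
    using \<Theta> unfolding theta_maps_def by blast
  have X: "subgroup X S" and Y: "subgroup Y S" using XY Iso_dom Iso_cod by blast+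
  show ?thesis
  proof (cases "X = Y")
    case True
    have "\<Theta> X X = (\<lambda>x \<in> X. x)" using sub X unfolding subgroup_maps_def by blast
    moreover have "inv_map X (\<lambda>x \<in> X. x) = (\<lambda>x \<in> X. x)"
      by (rule inv_map_eqI) (auto simp: inj_on_def)
    ultimately show ?thesis using True Iso_id[OF X] by metis
  next
    case False
    have "rep S \<A> V Y \<in> fusion_component S Qs \<A> V (rep S \<A> V X)"
      using Iso_iff_component[OF X Y] XY by blast
    then obtain R T \<beta> \<delta> where RT: "{X, Y} = {R, T}"
      and \<beta>: "\<beta> \<in> \<A> (carrier S)" "R = \<beta> ` rep S \<A> V R"
      and \<delta>: "\<delta> \<in> \<A> (carrier S)" "T = \<delta> ` rep S \<A> V T"
      and eq: "\<Theta> R T = (\<lambda>x \<in> R. \<delta> (\<Theta>' (rep S \<A> V R) (rep S \<A> V T) (inv_into (carrier S) \<beta> x)))"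
      and TR: "\<Theta> T R = inv_map R (\<Theta> R T)"
      using sub X Y False unfolding subgroup_maps_def by metis
    have R: "subgroup R S" and T: "subgroup T S" and "Iso R T \<noteq> {}"
      using RT X Y XY Iso_inv_map by (auto simp: doubleton_eq_iff)
    then have "\<Theta>' (rep S \<A> V R) (rep S \<A> V T) \<in> Iso (rep S \<A> V R) (rep S \<A> V T)"
      using vertex_maps_Iso[OF \<theta> \<Theta>' rep_in_V[OF R]] Iso_iff_component[OF R T] by blast
    from subgroup_map_Iso[OF this \<beta> \<delta>] have i: "\<Theta> R T \<in> Iso R T" unfolding eq .
    have "\<Theta> T R \<in> Iso T R" unfolding TR by (rule Iso_inv_map[OF i])
    moreover have "\<Theta> R T = inv_map T (\<Theta> T R)"
      unfolding TR using inv_map_inv_map[OF Iso_inj_on[OF i] Iso_extensional[OF i]] Iso_image[OF i]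
      by simp
    ultimately show ?thesis using i TR RT by (metis doubleton_eq_iff)
  qed
qed

end


section \<open>Generation of the automorphism groups\<close>

locale finite_fusion_theta = finite_fusion_graph S Qs \<A> V
  for S (structure) and Qs :: "'a set list" and \<A> :: "'a set \<Rightarrow> ('a \<Rightarrow> 'a) set"
    and V :: "'a set set" +
  fixes \<Theta> :: "'a set \<Rightarrow> 'a set \<Rightarrow> 'a \<Rightarrow> 'a"
  assumes theta: "theta_maps S Qs \<A> V \<Theta>"
begin

lemma \<Theta>_Iso: "Iso X Y \<noteq> {} \<Longrightarrow> \<Theta> X Y \<in> Iso X Y"
  and \<Theta>_inv_map: "Iso X Y \<noteq> {} \<Longrightarrow> \<Theta> Y X = inv_map X (\<Theta> X Y)"
  using theta_maps_Iso[OF theta] by blast+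

lemma \<Theta>_self: "subgroup X S \<Longrightarrow> \<Theta> X X = (\<lambda>x \<in> X. x)"
  using theta unfolding theta_maps_def subgroup_maps_def by blast

lemma \<Theta>_cancel: "Iso X Y \<noteq> {} \<Longrightarrow> x \<in> X \<Longrightarrow> \<Theta> Y X (\<Theta> X Y x) = x"
  using \<Theta>_inv_map inv_map_left[OF Iso_inj_on[OF \<Theta>_Iso]] by metis

lemma \<Theta>_closed: "Iso X Y \<noteq> {} \<Longrightarrow> x \<in> X \<Longrightarrow> \<Theta> X Y x \<in> Y"
  using Iso_image[OF \<Theta>_Iso] by blast

lemma generate_Iso: "subgroup P S \<Longrightarrow> K \<subseteq> Iso P P \<Longrightarrow> generate (Aut_group S P) K \<subseteq> Iso P P"
  by (rule group.generate_subgroup_incl[OF group_Aut_group _ subgroup_Iso_self])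

lemma C_generator_Iso:
  assumes "Q \<in> set Qs" "T \<subseteq> Q" "\<mu> \<in> \<A> Q" "subgroup T S"
  shows "compose T (inv_map T \<mu>) (\<Theta> T (\<mu> ` T)) \<in> Iso T T"
proof -
  have r: "restrict \<mu> T \<in> Iso T (\<mu> ` T)" using Iso_restrict assms by blast
  have "inv_map T \<mu> = inv_map T (restrict \<mu> T)"
    using Iso_inj_on[OF r] by (intro inv_map_eqI[symmetric, where R = "\<mu> ` T"])
      (auto simp: inv_map_extensional inv_map_left inj_on_def)
  then have "inv_map T \<mu> \<in> Iso (\<mu> ` T) T" using Iso_inv_map[OF r] by simp
  then show ?thesis using Iso_compose \<Theta>_Iso r by blast
qed

lemma C_group_Iso: "subgroup T S \<Longrightarrow> C_group S Qs \<A> \<Theta> T \<subseteq> Iso T T"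
  unfolding C_group_def using C_generator_Iso by (intro generate_Iso) blast+

lemma B_group_Iso:
  assumes P: "subgroup P S" shows "B_group S Qs \<A> V \<Theta> P \<subseteq> Iso P P"
  unfolding B_group_def
proof (rule generate_Iso[OF P], clarify)
  fix T \<psi> assume "T \<in> graph_class S Qs \<A> V P" and \<psi>: "\<psi> \<in> C_group S Qs \<A> \<Theta> T"
  then have T: "Iso P T \<noteq> {}" "Iso T P \<noteq> {}" using graph_class_eq[OF P] Iso_nonempty_sym by auto
  moreover have "\<psi> \<in> Iso T T" using C_group_Iso[of T] \<psi> T Iso_dom by blast
  ultimately show "compose P (\<Theta> T P) (compose P \<psi> (\<Theta> P T)) \<in> Iso P P"
    using Iso_compose \<Theta>_Iso by blast
qed

lemma A_generators_Iso:
  assumes P: "subgroup P S"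
  shows "B_group S Qs \<A> V \<Theta> P \<union> {compose P (\<Theta> T P) (compose P (\<Theta> R T) (\<Theta> P R)) | R T.
    R \<in> graph_class S Qs \<A> V P - {P} \<and> T \<in> graph_class S Qs \<A> V P - {P}} \<subseteq> Iso P P"
proof -
  have "compose P (\<Theta> T P) (compose P (\<Theta> R T) (\<Theta> P R)) \<in> Iso P P"
    if "R \<in> graph_class S Qs \<A> V P" "T \<in> graph_class S Qs \<A> V P" for R T
  proof -
    have "Iso P R \<noteq> {}" "Iso R P \<noteq> {}" "Iso P T \<noteq> {}" "Iso T P \<noteq> {}"
      using that graph_class_eq[OF P] Iso_nonempty_sym by auto
    then have "Iso P R \<noteq> {}" "Iso R T \<noteq> {}" "Iso T P \<noteq> {}"
      using Iso_nonempty_trans by metis+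
    then show ?thesis using Iso_compose \<Theta>_Iso by blast
  qed
  then show ?thesis using B_group_Iso[OF P] by blast
qed

lemma A_group_Iso: "subgroup P S \<Longrightarrow> A_group S Qs \<A> V \<Theta> P \<subseteq> Iso P P"
  unfolding A_group_def by (rule generate_Iso[OF _ A_generators_Iso])

lemma subgroup_A_group: "subgroup P S \<Longrightarrow> subgroup (A_group S Qs \<A> V \<Theta> P) (Aut_group S P)"
  unfolding A_group_def 
  by (rule group.generate_is_subgroup[OF group_Aut_group
        order_trans[OF A_generators_Iso Iso_self_carrier]])

lemma A_group_id: "subgroup P S \<Longrightarrow> (\<lambda>x \<in> P. x) \<in> A_group S Qs \<A> V \<Theta> P"
  using subgroup.one_closed[OF subgroup_A_group] by (simp only: one_Aut_group)

lemma A_group_compose: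
  assumes P: "subgroup P S"
    and "\<phi> \<in> A_group S Qs \<A> V \<Theta> P" "\<psi> \<in> A_group S Qs \<A> V \<Theta> P"
  shows "compose P \<phi> \<psi> \<in> A_group S Qs \<A> V \<Theta> P"
proof -
  note sub = subgroup_A_group[OF P]
  have "\<phi> \<in> carrier (Aut_group S P)" "\<psi> \<in> carrier (Aut_group S P)"
    using subgroup.subset[OF sub] assms(2,3) by auto
  then show ?thesis using subgroup.m_closed[OF sub assms(2,3)] by (simp only: mult_Aut_group)
qed

lemma C_group_inv_map:
  assumes T: "subgroup T S" and \<psi>: "\<psi> \<in> C_group S Qs \<A> \<Theta> T"
  shows "inv_map T \<psi> \<in> C_group S Qs \<A> \<Theta> T"
proof -
  have "{compose T (inv_map T \<mu>) (\<Theta> T (\<mu> ` T)) | \<mu> Q. Q \<in> set Qs \<and> T \<subseteq> Q \<and> \<mu> \<in> \<A> Q} \<subseteq> Iso T T"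
    using C_generator_Iso[OF _ _ _ T] by blast
  then have sub: "subgroup (C_group S Qs \<A> \<Theta> T) (Aut_group S T)"
    unfolding C_group_def
    by (intro group.generate_is_subgroup[OF group_Aut_group[OF T]] order_trans[OF _ Iso_self_carrier])
  have "\<psi> \<in> carrier (Aut_group S T)" using subgroup.subset[OF sub] \<psi> by blast
  then show ?thesis using subgroup.m_inv_closed[OF sub \<psi>] inv_map_Aut_group[OF T] by simp
qed

lemma B_generator_A_group:
  assumes P: "subgroup P S" and T: "Iso P T \<noteq> {}" and \<psi>: "\<psi> \<in> C_group S Qs \<A> \<Theta> T"
  shows "compose P (\<Theta> T P) (compose P \<psi> (\<Theta> P T)) \<in> A_group S Qs \<A> V \<Theta> P"
proof -
  have "T \<in> graph_class S Qs \<A> V P" using graph_class_eq[OF P] T by simp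
  then have "compose P (\<Theta> T P) (compose P \<psi> (\<Theta> P T)) \<in> B_group S Qs \<A> V \<Theta> P"
    unfolding B_group_def using \<psi> by (intro generate.incl) blast
  then show ?thesis unfolding A_group_def by (intro generate.incl) blast
qed

text \<open>
  The generators of \<open>A\<^sub>P\<close> only include the triangles with \<open>R\<close> and \<open>T\<close> different from \<open>P\<close>; if one of
  them is \<open>P\<close>, the triangle collapses to \<open>\<Theta>\<^bsub>P,X\<^esub>\<Theta>\<^bsub>X,P\<^esub> = 1\<close>.
\<close>

lemma triangle_A_group:
  assumes P: "subgroup P S" and R: "Iso P R \<noteq> {}" and T: "Iso P T \<noteq> {}"
  shows "compose P (\<Theta> T P) (compose P (\<Theta> R T) (\<Theta> P R)) \<in> A_group S Qs \<A> V \<Theta> P" (is "?f \<in> _")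
proof (cases "R = P \<or> T = P")
  case True
  have "?f = (\<lambda>x \<in> P. x)"
  proof (rule extensionalityI[where A = P])
    fix x assume x: "x \<in> P"
    have "\<Theta> T P (\<Theta> R T (\<Theta> P R x)) = x"
      using True
    proof
      assume "R = P"
      then show ?thesis using \<Theta>_cancel[OF T x] \<Theta>_self[OF P] x by simp
    next
      assume "T = P"
      then show ?thesis using \<Theta>_cancel[OF R x] \<Theta>_self[OF P] x by simp
    qed
    then show "?f x = (\<lambda>x \<in> P. x) x" using x by (simp add: compose_def)
  qed auto
  then show ?thesis using A_group_id[OF P] by simp
next
  case False
  then have "R \<in> graph_class S Qs \<A> V P - {P}" "T \<in> graph_class S Qs \<A> V P - {P}"
    using graph_class_eq[OF P] R T by auto
  then show ?thesis unfolding A_group_def by (intro generate.incl) blast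
qed

text \<open>
  The heart of the matter: any composite starting at \<open>P\<close>, closed up by \<open>\<Theta>\<close> to a loop at \<open>P\<close>, lies in
  \<open>A\<^sub>P\<close>. Stating it for composites that end anywhere is what makes the induction on the number of
  factors possible.
\<close>

lemma composite_A_group:
  assumes P: "subgroup P S" and "composite P \<phi>"
  shows "compose P (\<Theta> (\<phi> ` P) P) \<phi> \<in> A_group S Qs \<A> V \<Theta> P"
  using assms(2)
proof induction
  case composite_id
  have "(\<lambda>x \<in> P. x) ` P = P" by auto
  moreover have "compose P (\<Theta> P P) (\<lambda>x \<in> P. x) = (\<lambda>x \<in> P. x)"
    unfolding \<Theta>_self[OF P] by (rule compose_id_left) auto
  ultimately show ?case using A_group_id[OF P] by metis
next
  case (composite_step \<phi> Q \<mu>)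
  define T U where T: "T = \<phi> ` P" and U: "U = \<mu> ` T"
  note \<mu> = \<open>Q \<in> set Qs\<close> \<open>\<mu> \<in> \<A> Q\<close>
  have \<phi>I: "\<phi> \<in> Iso P T" using P composite_step by (simp add: Iso_def T)
  have TQ: "T \<subseteq> Q" unfolding T using composite_step by blast
  have Ts: "subgroup T S" by (rule Iso_cod[OF \<phi>I])
  have TU: "Iso T U \<noteq> {}" using Iso_restrict[OF \<mu> TQ Ts] U by blast
  have PT: "Iso P T \<noteq> {}" and TP: "Iso T P \<noteq> {}" and PU: "Iso P U \<noteq> {}"
    using \<phi>I TU Iso_nonempty_sym Iso_nonempty_trans by (metis empty_iff)+
  define \<psi> where \<psi>: "\<psi> = compose T (inv_map T \<mu>) (\<Theta> T U)"
  have \<psi>C: "\<psi> \<in> C_group S Qs \<A> \<Theta> T"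
    unfolding C_group_def \<psi> U using \<mu> TQ by (intro generate.incl) blast
  have \<psi>I: "\<psi> \<in> Iso T T" using C_group_Iso[OF Ts] \<psi>C by blast
  \<comment> \<open>The new loop is \<open>f1 \<circ> f2 \<circ> f3\<close>: the old loop \<open>f3\<close>, then \<open>\<psi>\<^sup>-\<^sup>1\<close> transported to \<open>P\<close>, which corrects
    the last factor \<open>\<mu>\<close> to \<open>\<Theta> T U\<close>, and then the triangle through \<open>T\<close> and \<open>U\<close>.\<close>
  define f1 where f1: "f1 = compose P (\<Theta> U P) (compose P (\<Theta> T U) (\<Theta> P T))"
  define f2 where f2: "f2 = compose P (\<Theta> T P) (compose P (inv_map T \<psi>) (\<Theta> P T))"
  define f3 where f3: "f3 = compose P (\<Theta> T P) \<phi>"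
  have "f1 \<in> A_group S Qs \<A> V \<Theta> P" unfolding f1 by (rule triangle_A_group[OF P PT PU])
  moreover have "f2 \<in> A_group S Qs \<A> V \<Theta> P"
    unfolding f2 by (rule B_generator_A_group[OF P PT C_group_inv_map[OF Ts \<psi>C]])
  moreover have "f3 \<in> A_group S Qs \<A> V \<Theta> P"
    unfolding f3 T by (rule composite_step.IH)
  ultimately have f: "compose P f1 (compose P f2 f3) \<in> A_group S Qs \<A> V \<Theta> P"
    by (intro A_group_compose[OF P])
  have "compose P f1 (compose P f2 f3) = compose P (\<Theta> U P) (compose P \<mu> \<phi>)"
  proof (rule extensionalityI[where A = P])
    fix x assume x: "x \<in> P"
    define t where t: "t = \<phi> x"
    define s where s: "s = inv_map T \<psi> t"
    have tT: "t \<in> T" using x by (simp add: t T)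
    have sT: "s \<in> T" using Iso_image[OF Iso_inv_map[OF \<psi>I]] tT s by blast
    \<comment> \<open>By definition of \<open>\<psi>\<close>, the equation \<open>\<psi> s = t\<close> means that \<open>\<Theta> T U\<close> does at \<open>s\<close> what \<open>\<mu>\<close> does at \<open>t\<close>.\<close>
    have st: "\<psi> s = t"
      using tT Iso_image[OF \<psi>I] inv_map_left[OF Iso_inj_on[OF \<psi>I]] s by (metis imageE)
    have "\<Theta> T U s \<in> \<mu> ` T" using \<Theta>_closed[OF TU sT] U by simp
    then obtain u where u: "u \<in> T" "\<Theta> T U s = \<mu> u" by blast
    have "inj_on \<mu> T" using inj_on_subset[OF \<A>_inj_on[OF \<mu>] TQ] .
    then have "u = t" using st u sT inv_map_left[of \<mu> T u] by (simp add: \<psi> compose_def)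
    then have key: "\<Theta> T U s = \<mu> t" using u by simp
    have q: "\<Theta> T P t \<in> P" "\<Theta> T P s \<in> P" using \<Theta>_closed[OF TP] tT sT by auto
    have c: "\<Theta> P T (\<Theta> T P t) = t" "\<Theta> P T (\<Theta> T P s) = s" using \<Theta>_cancel[OF TP] tT sT by auto
    have "f3 x = \<Theta> T P t" using x by (simp add: f3 compose_def t)
    moreover have "f2 (\<Theta> T P t) = \<Theta> T P s" using q c by (simp add: f2 compose_def s)
    moreover have "f1 (\<Theta> T P s) = \<Theta> U P (\<mu> t)" using q c key by (simp add: f1 compose_def)
    ultimately show "compose P f1 (compose P f2 f3) x = compose P (\<Theta> U P) (compose P \<mu> \<phi>) x"
      using x by (simp add: compose_def t)
  qed auto
  then show ?case using f by (simp add: compose_image U T)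
qed

text \<open>
  An automorphism of \<open>P\<close> in the fusion system is a composite that ends at \<open>P\<close>, where the closing map
  \<open>\<Theta>\<^bsub>P,P\<^esub>\<close> is the identity.
\<close>

theorem A_group_eq:
  assumes P: "subgroup P S"
  shows "generated_fusion S Qs \<A> P P = A_group S Qs \<A> V \<Theta> P"
  unfolding generated_fusion_Aut[OF P]
proof (intro equalityI subsetI)
  fix \<phi> assume \<phi>: "\<phi> \<in> Iso P P"
  have "compose P (\<lambda>x \<in> P. x) \<phi> = \<phi>"
    using \<phi> by (intro compose_id_left) (auto simp: Iso_extensional Iso_image)
  then show "\<phi> \<in> A_group S Qs \<A> V \<Theta> P"
    using composite_A_group[OF P Iso_composite[OF \<phi>]] Iso_image[OF \<phi>] \<Theta>_self[OF P] by simp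
next
  fix \<phi> assume "\<phi> \<in> A_group S Qs \<A> V \<Theta> P"
  then show "\<phi> \<in> Iso P P" using A_group_Iso[OF P] by blast
qed

end


section \<open>Computing in a fusion system with the fusion graph\<close>


theorem theorem3p9:
  fixes p :: nat
    and S :: "('a, 'b) monoid_scheme"
    and Qs :: "'a set list"
    and \<A> :: "'a set \<Rightarrow> ('a \<Rightarrow> 'a) set"
    and V :: "'a set set"
    and \<Theta> :: "'a set \<Rightarrow> 'a set \<Rightarrow> 'a \<Rightarrow> 'a"
  defines "F \<equiv> generated_fusion S Qs \<A>"
  assumes "finite_p_group p S"
    and "fusion_datum S Qs \<A>"
    and "orbit_reps S Qs \<A> V"
    and "theta_maps S Qs \<A> V \<Theta>"
  shows
    "(\<forall>P R. subgroup P S \<longrightarrow> subgroup R S \<longrightarrow>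
        (R \<in> conj_class S F P \<longleftrightarrow>
           rep S \<A> V R \<in> fusion_component S Qs \<A> V (rep S \<A> V P)) \<and>
        (R \<in> conj_class S F P \<longrightarrow> \<Theta> P R \<in> F P R)) \<and>
     (\<forall>P. subgroup P S \<longrightarrow> F P P = A_group S Qs \<A> V \<Theta> P) \<and>
     (automizer_sequence p S Qs \<A> \<longleftrightarrow>
        (\<forall>Q \<in> set Qs.
           A_group S Qs \<A> V \<Theta> Q = \<A> Q \<and>
           (\<forall>X \<in> fusion_component S Qs \<A> V Q. centric S X) \<and>
           sylow_subgroup p ((Aut_group S Q)\<lparr>carrier := \<A> Q\<rparr>) (Hom_S S Q Q) \<and>
           (Q \<noteq> carrier S \<longrightarrow> has_strongly_p_embedded_outer p S \<A> Q)))"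
proof -
  have S: "group S" "finite (carrier S)" using assms(2) by (auto simp: finite_p_group_def)
  interpret finite_fusion_theta S Qs \<A> V \<Theta>
    using S assms(3-5)
    by (auto simp: finite_fusion_theta_def finite_fusion_theta_axioms_def finite_fusion_graph_def
      finite_fusion_graph_axioms_def finite_fusion_datum_def finite_fusion_datum_axioms_def)
  have conj: "R \<in> conj_class S F P \<longleftrightarrow> Iso P R \<noteq> {}" for P R
    unfolding F_def by (rule conj_class_iff)
  have "R \<in> conj_class S F P \<longleftrightarrow> rep S \<A> V R \<in> fusion_component S Qs \<A> V (rep S \<A> V P)"
    if "subgroup P S" "subgroup R S" for P R
    unfolding conj by (rule Iso_iff_component[OF that])
  moreover have "\<Theta> P R \<in> F P R" if "R \<in> conj_class S F P" for P R
    using Iso_composite_maps[OF \<Theta>_Iso] that[unfolded conj] by (simp add: F_def generated_fusion_eq)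
  moreover have Aut: "F P P = A_group S Qs \<A> V \<Theta> P" if "subgroup P S" for P
    unfolding F_def by (rule A_group_eq[OF that])
  moreover have "F Q Q = A_group S Qs \<A> V \<Theta> Q" "fusion_centric S F Q \<longleftrightarrow>
      (\<forall>X \<in> fusion_component S Qs \<A> V Q. centric S X)" if "Q \<in> set Qs" for Q
    using Aut[OF subgroup_Q[OF that]] fusion_centric_iff_component[OF Qs_V[OF that]]
    unfolding F_def by simp_all
  then have "automizer_sequence p S Qs \<A> \<longleftrightarrow>
      (\<forall>Q \<in> set Qs.
         A_group S Qs \<A> V \<Theta> Q = \<A> Q \<and>
         (\<forall>X \<in> fusion_component S Qs \<A> V Q. centric S X) \<and>
         sylow_subgroup p ((Aut_group S Q)\<lparr>carrier := \<A> Q\<rparr>) (Hom_S S Q Q) \<and>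
         (Q \<noteq> carrier S \<longrightarrow> has_strongly_p_embedded_outer p S \<A> Q))"
    unfolding automizer_sequence_def F_def[symmetric] by (intro ball_cong refl) auto
  ultimately show ?thesis by (intro conjI allI impI) simp_all
qed

end
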